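(* Let $T$ be a tournament on a finite non-empty set $X$, with optimal strategy $p^{\ast}\in\Delta(X)$. For any initial urn $n_0\in\mathcal N$, the random urn sequence $(n_\tau)_{\tau\in\mathbb N}$ obtained from $n_0$ by two-alternatives reinforcement is such that: 1. almost surely, for all $x\in X$ such that $p^{\ast}(x)=0$, $\widetilde{n_\tau}(x)\to 0$ as $\tau\to\infty$; 2. if $T$ has no Condorcet winner, then with positive probability the sequence $(\widetilde{n_\tau})_{\tau\in\mathbb N}$ has no limit as $\tau\to\infty$; 3. if $T$ has no Condorcet winner and $p^{\ast}(x)>0$ for all $x\in X$, then with probability one the sequence $(\widetilde{n_\tau})_{\tau\in\mathbb N}$ has no limit as $\tau\to\infty$.
   Context: A tournament $T$ on a finite set $X$ is a complete antisymmetric binary relation: for any $x,y\in X$ exactly one of $x=y$, $x\,T\,y$, $y\,T\,x$ holds. Write $\max\{x,y\}=x$ if $x\,T\,y$ or $x=y$, and $\max\{x,y\}=y$ if $y\,T\,x$. A Condorcet winner is an element $c\in X$ with $c\,T\,x$ for all $x\in X\setminus\{c\}$ (in particular, if $X$ is a singleton its element is a Condorcet winner). $\Delta(X)$ is the set of probability distributions on $X$, with the topology induced from $\mathbb R^X$. Tournament game: $g(x,y)=+1$ if $x\,T\,y$, $g(x,y)=0$ if $x=y$, $g(x,y)=-1$ if $y\,T\,x$; for $p,q\in\Delta(X)$, $g(p,q)=\sum_{x,y\in X}g(x,y)p(x)q(y)$. It is a known fact that there is a unique $p^{\ast}\in\Delta(X)$ such that $g(p^{\ast},q)\ge 0$ for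 all $q\in\Delta(X)$; it is called the optimal strategy. An urn on $X$ is a family $n=(n(x))_{x\in X}$ of strictly positive integers ($n(x)$ is the number of balls of color $x$); $\mathcal N$ is the set of urns. For $n\in\mathcal N$, $\widetilde n\in\Delta(X)$ is defined by $\widetilde n(x)=n(x)/\sum_{y\in X}n(y)$. Two-alternatives reinforcement is the Markov chain $(n_\tau)_{\tau\in\mathbb N}$ on $\mathcal N$ defined as follows: given $n_\tau$, draw $a,b\in X$ independently according to $\widetilde{n_\tau}$, put $x=\max\{a,b\}$, and add one ball of color $x$, i.e. $n_{\tau+1}(x)=n_\tau(x)+1$ and $n_{\tau+1}(v)=n_\tau(v)$ for $v\ne x$. *)

theory Defs
  imports "HOL-Probability.Probability"
begin

text \<open>
  The finite non-empty set of alternatives is the universe of a type \<open>'a :: finite\<close>, and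
  \<open>real ^ 'a\<close> is the space of real vectors indexed by the alternatives.
\<close>

definition tournament :: "('a \<Rightarrow> 'a \<Rightarrow> bool) \<Rightarrow> bool" where
  "tournament T \<longleftrightarrow>
     (\<forall>x y. (x = y \<and> \<not> T x y \<and> \<not> T y x) \<or>
            (x \<noteq> y \<and> T x y \<and> \<not> T y x) \<or>
            (x \<noteq> y \<and> \<not> T x y \<and> T y x))"

definition tmax :: "('a \<Rightarrow> 'a \<Rightarrow> bool) \<Rightarrow> 'a \<Rightarrow> 'a \<Rightarrow> 'a" where
  "tmax T x y = (if T x y \<or> x = y then x else y)"

definition condorcet_winner :: "('a \<Rightarrow> 'a \<Rightarrow> bool) \<Rightarrow> 'a \<Rightarrow> bool" where
  "condorcet_winner T c \<longleftrightarrow> (\<forall>x. x \<noteq> c \<longrightarrow> T c x)"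

definition prob_simplex :: "(real ^ 'a::finite) set" where
  "prob_simplex = {p. (\<forall>x. 0 \<le> p $ x) \<and> (\<Sum>x\<in>UNIV. p $ x) = 1}"

definition payoff :: "('a \<Rightarrow> 'a \<Rightarrow> bool) \<Rightarrow> 'a \<Rightarrow> 'a \<Rightarrow> real" where
  "payoff T x y = (if T x y then 1 else if x = y then 0 else - 1)"

definition mixed_payoff :: "('a::finite \<Rightarrow> 'a \<Rightarrow> bool) \<Rightarrow> real ^ 'a \<Rightarrow> real ^ 'a \<Rightarrow> real" where
  "mixed_payoff T p q = (\<Sum>x\<in>UNIV. \<Sum>y\<in>UNIV. payoff T x y * p $ x * q $ y)"

definition optimal_strategy :: "('a::finite \<Rightarrow> 'a \<Rightarrow> bool) \<Rightarrow> real ^ 'a \<Rightarrow> bool" where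
  "optimal_strategy T p \<longleftrightarrow> p \<in> prob_simplex \<and> (\<forall>q\<in>prob_simplex. 0 \<le> mixed_payoff T p q)"

definition urn :: "('a \<Rightarrow> nat) \<Rightarrow> bool" where
  "urn n \<longleftrightarrow> (\<forall>x. 0 < n x)"

definition composition :: "('a::finite \<Rightarrow> nat) \<Rightarrow> real ^ 'a" where
  "composition n = (\<chi> x. real (n x) / (\<Sum>y\<in>UNIV. real (n y)))"

text \<open>
  The function passed to \<open>embed_pmf\<close> below is a genuine probability mass function as soon as
  \<open>n\<close> is an urn, see \<open>pmf_draw\<close>; for other \<open>n\<close> nothing is claimed.
\<close>

definition draw :: "('a::finite \<Rightarrow> nat) \<Rightarrow> 'a pmf" where
  "draw n = embed_pmf (\<lambda>x. composition n $ x)"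

lemma composition_in_prob_simplex:
  assumes "urn n"
  shows "composition n \<in> prob_simplex"
proof -
  have "0 < (\<Sum>y\<in>UNIV. real (n y))"
    using assms by (intro sum_pos) (auto simp: urn_def)
  then show ?thesis
    by (auto simp: prob_simplex_def composition_def sum_divide_distrib[symmetric])
qed

lemma pmf_draw:
  assumes "urn n"
  shows "pmf (draw n) x = composition n $ x"
  unfolding draw_def using composition_in_prob_simplex[OF assms]
  by (subst pmf_embed_pmf)
     (auto simp: prob_simplex_def nn_integral_count_space_finite sum_ennreal)

text \<open>The two draws are independent, with replacement.\<close>

definition reinforce :: "('a::finite \<Rightarrow> 'a \<Rightarrow> bool) \<Rightarrow> ('a \<Rightarrow> nat) \<Rightarrow> ('a \<Rightarrow> nat) pmf" where
  "reinforce T n =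
     do {
       a \<leftarrow> draw n;
       b \<leftarrow> draw n;
       let x = tmax T a b;
       return_pmf (n(x := n x + 1))
     }"

text \<open>
  \<open>markov_chain_from M K s0 N\<close>: on the probability space \<open>M\<close>, the process \<open>N\<close> is a
  time-homogeneous Markov chain on a countable state space, with transition kernel \<open>K\<close> and
  started at \<open>s0\<close>. The Markov property is stated in product form, which avoids conditioning on
  null events.
\<close>

definition markov_chain_from ::
    "'w measure \<Rightarrow> ('s::countable \<Rightarrow> 's pmf) \<Rightarrow> 's \<Rightarrow> (nat \<Rightarrow> 'w \<Rightarrow> 's) \<Rightarrow> bool" where
  "markov_chain_from M K s0 N \<longleftrightarrow>
     prob_space M \<and>
     (\<forall>t. N t \<in> measurable M (count_space UNIV)) \<and>
     (AE \<omega> in M. N 0 \<omega> = s0) \<and>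
     (\<forall>t s. measure M {\<omega> \<in> space M. \<forall>i\<le>Suc t. N i \<omega> = s i} =
            measure M {\<omega> \<in> space M. \<forall>i\<le>t. N i \<omega> = s i} * pmf (K (s t)) (s (Suc t)))"

end

theory Submission
  imports Defs "HOL-Number_Theory.Cong"
begin

text \<open>
  Write \<open>m\<close> for the composition of the urn \<open>n\<close>, \<open>S\<close> for its number of balls and \<open>g(x, m)\<close> for
  the payoff of \<open>x\<close> against \<open>m\<close>. A ball of colour \<open>x\<close> is added with probability
  \<open>m(x) (1 + g(x, m))\<close>, so \<open>m\<close> follows, with steps of size \<open>1 / S\<close>, a noisy version of the
  replicator dynamics of a zero-sum game. For these dynamics the relative entropy of the optimal
  strategy \<open>p\<close> with respect to \<open>m\<close> is non-increasing. The discrete counterpart used here is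
  \<open>potential\<close>, in which the logarithm is replaced by harmonic sums: it is non-negative, and its
  conditional drift is exactly \<open>-dissipation\<close>, a multiple of \<open>1 / S\<close> which is linear in the mass
  that \<open>m\<close> puts outside the support of \<open>p\<close> (\<open>expected_potential\<close>). The strict inequality
  \<open>g(x, p) < 0\<close> outside the support comes from a parity argument: a skew-symmetric matrix of even
  size with entries \<open>1\<close> and \<open>-1\<close> off the diagonal is invertible, because its square is the
  identity modulo \<open>2\<close> (\<open>tournament_even_nonsingular\<close>).

  Colours outside the support. The expected total dissipation is bounded by the initial
  potential, hence \<open>m(x) / S\<close> is almost surely summable over time for every \<open>x\<close> outside the
  support. As \<open>m(x)\<close> moves by at most \<open>1 / S\<close> per step, it must tend to \<open>0\<close>.

  Possible limits. If \<open>m\<close> converges, a law of large numbers forces the limit to be a rest point of the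
  replicator dynamics; it charges every colour of the support, because the potential cannot
  diverge, and no other colour; the parity argument leaves \<open>p\<close> as the only candidate. Hence convergence entails that the
  potential tends to \<open>0\<close> (\<open>AE_convergent_potential\<close>).

  Escape from the optimum. Without a Condorcet winner the noise can keep the potential \<open>D\<close> away
  from \<open>0\<close>. Near \<open>p\<close> the conditional variance of an increment of \<open>D\<close> is \<open>O(D / S^2)\<close>, so the
  second moment of all future increments is \<open>O(D / S)\<close>. This is what the function
  \<open>D - l (D^2 + 36 D / S) - const * outside mass\<close> (\<open>barrier\<close>) expresses: its positive part is a
  submartingale, bounded by \<open>1 / l\<close> and by \<open>D\<close>. A positive expectation therefore cannot
  decay, whereas it would have to decay if \<open>D\<close> tended to \<open>0\<close>.
  From a reachable urn with positive barrier this gives non-convergence with positive probability. If \<open>p\<close> has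
  full support, then \<open>D\<close> is at least of order \<open>1 / S\<close> by the discreteness of the urn, so \<open>l\<close> can
  be chosen proportional to \<open>1 / D\<close>, and from every urn close enough to \<open>p\<close> the probability
  of \<open>D\<close> not tending to \<open>0\<close> is at least a fixed positive constant. An
  approximation of the event \<open>D \<longlonglongrightarrow> 0\<close> by events that depend on finite histories then shows that
  it is a null event (\<open>AE_not_convergent\<close>).
\<close>

section \<open>Optimal strategies of tournament games\<close>

definition advantage :: "('a::finite \<Rightarrow> 'a \<Rightarrow> bool) \<Rightarrow> 'a \<Rightarrow> real ^ 'a \<Rightarrow> real" where
  "advantage T x v = (\<Sum>y\<in>UNIV. payoff T x y * v $ y)"

lemma payoff_antisym: "tournament T \<Longrightarrow> payoff T y x = - payoff T x y"
  unfolding tournament_def payoff_def by (smt (verit, best))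

lemma abs_payoff_le: "\<bar>payoff T x y\<bar> \<le> 1"
  by (simp add: payoff_def)

lemma advantage_skew:
  assumes "tournament T"
  shows "(\<Sum>x\<in>UNIV. u $ x * advantage T x v) = - (\<Sum>x\<in>UNIV. v $ x * advantage T x u)"
proof -
  have "(\<Sum>x\<in>UNIV. u $ x * advantage T x v) = (\<Sum>x\<in>UNIV. \<Sum>y\<in>UNIV. payoff T x y * u $ x * v $ y)"
    by (simp add: advantage_def sum_distrib_left mult_ac)
  also have "\<dots> = (\<Sum>y\<in>UNIV. \<Sum>x\<in>UNIV. payoff T x y * u $ x * v $ y)"
    by (rule sum.swap)
  also have "\<dots> = (\<Sum>y\<in>UNIV. \<Sum>x\<in>UNIV. - (v $ y * (payoff T y x * u $ x)))"
    by (intro sum.cong refl) (subst payoff_antisym[OF assms], simp)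
  also have "\<dots> = - (\<Sum>x\<in>UNIV. v $ x * advantage T x u)"
    by (simp add: advantage_def sum_distrib_left sum_negf)
  finally show ?thesis .
qed

lemma det_cong_mod:
  fixes A B :: "int ^ 'n ^ 'n"
  assumes "\<And>i j. [A $ i $ j = B $ i $ j] (mod m)"
  shows "[det A = det B] (mod m)"
  unfolding det_def by (intro cong_sum cong_mult cong_prod cong_refl assms)

lemma det_of_int: "det (\<chi> i j. real_of_int (A $ i $ j)) = real_of_int (det A)"
  by (simp add: det_def)

text \<open>
  Restricted to \<open>F\<close>, the payoff matrix is congruent modulo \<open>2\<close> to \<open>J - I\<close>, where \<open>J\<close> is the all-ones
  matrix. As \<open>(J - I)^2 = card F * J - 2 J + I\<close>, its square is congruent to the identity when
  \<open>card F\<close> is even, so its determinant is odd and the kernel is trivial, also over the reals.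
\<close>
lemma tournament_even_nonsingular:
  fixes v :: "real ^ 'a::finite"
  assumes T: "tournament T" and ev: "even (card F)"
    and supp: "\<And>x. x \<notin> F \<Longrightarrow> v $ x = 0"
    and ker: "\<And>x. x \<in> F \<Longrightarrow> advantage T x v = 0"
  shows "v = 0"
proof -
  \<comment> \<open>The payoffs on \<open>F\<close>, completed by the identity matrix outside \<open>F\<close>.\<close>
  define B :: "int ^ 'a ^ 'a" where
    "B = (\<chi> i j. if i \<in> F \<and> j \<in> F then (if T i j then 1 else if i = j then 0 else - 1)
                  else of_bool (i = j))"
  have TT: "\<not> T i i" for i using T by (auto simp: tournament_def)
  have sq: "[(B ** B) $ i $ j = mat 1 $ i $ j] (mod 2)" for i j
  proof (cases "i \<in> F \<and> j \<in> F")
    case True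
    have "(B ** B) $ i $ j = (\<Sum>k\<in>UNIV. B $ i $ k * B $ k $ j)"
      by (simp add: matrix_matrix_mult_def)
    also have "[\<dots> = (\<Sum>k\<in>UNIV. of_bool (k \<in> F - {i, j}))] (mod 2)"
      by (intro cong_sum) (use True in \<open>auto simp: B_def cong_def TT\<close>)
    also have "(\<Sum>k\<in>UNIV. of_bool (k \<in> F - {i, j})) = int (card (F - {i, j}))"
      by (simp add: of_bool_def set_diff_eq flip: sum.inter_filter)
    finally have *: "[(B ** B) $ i $ j = int (card (F - {i, j}))] (mod 2)" .
    have "even (card (F - {i, j})) \<longleftrightarrow> i \<noteq> j"
    proof (cases "i = j")
      case True
      have "card F = Suc (card (F - {i, j}))"
        using True \<open>i \<in> F \<and> j \<in> F\<close> card_Suc_Diff1[of F i] by simp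
      then show ?thesis using ev True by simp
    next
      case False
      have "card F = Suc (Suc (card (F - {i, j})))"
        using False \<open>i \<in> F \<and> j \<in> F\<close> card_Suc_Diff1[of F i] card_Suc_Diff1[of "F - {i}" j]
        by (simp add: Diff_insert2[of F i "{j}"])
      then show ?thesis using ev False by simp
    qed
    then have "[int (card (F - {i, j})) = mat 1 $ i $ j] (mod 2)"
      unfolding cong_def mat_def by (cases "i = j") (simp_all, presburger)
    with * show ?thesis by (rule cong_trans)
  next
    case False
    have "(B ** B) $ i $ j = mat 1 $ i $ j"
    proof (cases "i \<in> F")
      case True
      then have "j \<notin> F" using False by simp
      then have "(B ** B) $ i $ j = (\<Sum>k\<in>UNIV. if k = j then B $ i $ k else 0)"
        unfolding matrix_matrix_mult_def vec_lambda_beta by (intro sum.cong) (auto simp: B_def)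
      also have "\<dots> = mat 1 $ i $ j" using \<open>j \<notin> F\<close> by (simp add: B_def mat_def)
      finally show ?thesis .
    next
      case False
      then have "(B ** B) $ i $ j = (\<Sum>k\<in>UNIV. if k = i then B $ k $ j else 0)"
        unfolding matrix_matrix_mult_def vec_lambda_beta by (intro sum.cong) (auto simp: B_def)
      also have "\<dots> = mat 1 $ i $ j" using False by (simp add: B_def mat_def)
      finally show ?thesis .
    qed
    then show ?thesis by simp
  qed
  have "[det B * det B = 1] (mod 2)"
    using det_cong_mod[OF sq] by (simp add: det_mul)
  then have "det B \<noteq> 0" by (auto simp: cong_def)
  define A where "A = (\<chi> i j. real_of_int (B $ i $ j))"
  have "det A \<noteq> 0" using \<open>det B \<noteq> 0\<close> by (simp add: A_def det_of_int)
  have "A *v v = 0"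
  proof (rule vec_eq_iff[THEN iffD2, rule_format])
    fix i
    show "(A *v v) $ i = 0 $ i"
    proof (cases "i \<in> F")
      case True
      have "(A *v v) $ i = advantage T i v"
        unfolding matrix_vector_mult_def advantage_def vec_lambda_beta using True supp
        by (intro sum.cong) (auto simp: A_def B_def payoff_def)
      then show ?thesis using ker True by simp
    next
      case False
      have "(A *v v) $ i = (\<Sum>j\<in>UNIV. if j = i then v $ i else 0)"
        unfolding matrix_vector_mult_def vec_lambda_beta using False
        by (intro sum.cong) (auto simp: A_def B_def)
      then show ?thesis using supp[OF False] by simp
    qed
  qed
  then show ?thesis
    using \<open>det A \<noteq> 0\<close> by (metis invertible_det_nz invertible_def matrix_vector_mul_assoc
        matrix_vector_mul_lid matrix_vector_mult_0_right)
qed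

locale tournament_game =
  fixes T :: "'a::finite \<Rightarrow> 'a \<Rightarrow> bool" and p :: "real ^ 'a"
  assumes T: "tournament T" and p: "optimal_strategy T p"
begin

lemma optimal_strategy_simplex: "0 \<le> p $ x" "(\<Sum>x\<in>UNIV. p $ x) = 1"
  using p by (auto simp: optimal_strategy_def prob_simplex_def)

lemma advantage_optimal_le: "advantage T x p \<le> 0"
proof -
  have "axis x 1 \<in> (prob_simplex :: (real ^ 'a) set)"
    by (auto simp: prob_simplex_def axis_def)
  then have "0 \<le> mixed_payoff T p (axis x 1)" using p by (auto simp: optimal_strategy_def)
  also have "mixed_payoff T p (axis x 1) = (\<Sum>y\<in>UNIV. payoff T y x * p $ y)"
    by (simp add: mixed_payoff_def axis_def if_distrib[of "\<lambda>z. _ * z"] cong: if_cong)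
  also have "\<dots> = - advantage T x p"
    unfolding advantage_def sum_negf[symmetric]
    by (intro sum.cong refl) (subst payoff_antisym[OF T], simp)
  finally show ?thesis by simp
qed

text \<open>
  Complementary slackness: the payoffs against \<open>p\<close> are non-positive, and by skew-symmetry their
  \<open>p\<close>-average is \<open>0\<close>.
\<close>
lemma advantage_optimal_support:
  assumes "0 < p $ x" shows "advantage T x p = 0"
proof -
  have "(\<Sum>x\<in>UNIV. p $ x * - advantage T x p) = 0"
    using advantage_skew[OF T, of p p] by (simp add: sum_negf)
  then have "\<forall>x\<in>UNIV. p $ x * - advantage T x p = 0"
    by (subst (asm) sum_nonneg_eq_0_iff)
       (auto intro!: mult_nonneg_nonpos optimal_strategy_simplex advantage_optimal_le)
  then have "p $ x * - advantage T x p = 0" by blast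
  then show ?thesis using assms by simp
qed

text \<open>
  Strictness is the parity phenomenon. If \<open>y\<close> were a best reply outside the support, then \<open>p\<close> would
  be a kernel vector both on the set of all best replies and on this set without \<open>y\<close>; one of the
  two sets is even.
\<close>
lemma advantage_optimal_outside:
  assumes "p $ y = 0" shows "advantage T y p < 0"
proof (rule ccontr)
  assume "\<not> advantage T y p < 0"
  then have y: "advantage T y p = 0" using advantage_optimal_le[of y] by simp
  define E where "E = {z. advantage T z p = 0}"
  define F where "F = (if even (card E) then E else E - {y})"
  have "even (card F)"
    using card.remove[of E y] y by (auto simp: F_def E_def)
  moreover have "p $ x = 0" if "x \<notin> F" for x
    using that advantage_optimal_support[of x] optimal_strategy_simplex(1)[of x] assms
    by (fastforce simp: F_def E_def split: if_splits)
  ultimately have "p = 0"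
    by (rule tournament_even_nonsingular[OF T]) (auto simp: F_def E_def split: if_splits)
  then show False using optimal_strategy_simplex(2) by simp
qed

text \<open>
  A rest point of the replicator dynamics whose support is that of \<open>p\<close> satisfies these assumptions. The
  support of \<open>p\<close> has odd size, since \<open>p\<close> lies in the kernel; subtracting from \<open>m\<close> the multiple of \<open>p\<close> that
  agrees with it at one colour leaves a kernel vector on an even set.
\<close>
lemma optimal_strategy_unique_rest:
  assumes m: "\<And>x. p $ x = 0 \<Longrightarrow> m $ x = 0" "(\<Sum>x\<in>UNIV. m $ x) = 1"
    and rest: "\<And>x. 0 < p $ x \<Longrightarrow> advantage T x m = 0"
  shows "m = p"
proof -
  define B where "B = {x. 0 < p $ x}"
  have out: "x \<notin> B \<Longrightarrow> p $ x = 0" for x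
    using optimal_strategy_simplex(1)[of x] by (simp add: B_def)
  have "p \<noteq> 0" using optimal_strategy_simplex(2) by auto
  then obtain b where b: "b \<in> B" using out by (metis vec_eq_iff zero_index)
  have "odd (card B)"
  proof
    assume "even (card B)"
    then have "p = 0"
      by (rule tournament_even_nonsingular[OF T])
        (erule out, simp add: advantage_optimal_support B_def)
    then show False using \<open>p \<noteq> 0\<close> by simp
  qed
  then have ev: "even (card (B - {b}))" using b by (simp add: card_Diff_singleton)
  define c where "c = m $ b / p $ b"
  have "m - c *s p = 0"
  proof (rule tournament_even_nonsingular[OF T ev])
    fix x assume "x \<notin> B - {b}"
    show "(m - c *s p) $ x = 0"
    proof (cases "x = b")
      case True
      have "p $ b \<noteq> 0" using b by (simp add: B_def)
      then show ?thesis unfolding True c_def by simp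
    next
      case False
      then have "p $ x = 0" using out \<open>x \<notin> B - {b}\<close> by blast
      then show ?thesis using m(1) by simp
    qed
  next
    fix x assume "x \<in> B - {b}"
    have "advantage T x (m - c *s p) = advantage T x m - c * advantage T x p"
      unfolding advantage_def sum_distrib_left sum_subtractf[symmetric]
      by (intro sum.cong) (simp_all add: algebra_simps)
    with \<open>x \<in> B - {b}\<close> show "advantage T x (m - c *s p) = 0"
      using rest advantage_optimal_support by (auto simp: B_def)
  qed
  then have mc: "m = c *s p" by (simp only: right_minus_eq)
  then have "(\<Sum>x\<in>UNIV. m $ x) = c * (\<Sum>x\<in>UNIV. p $ x)"
    by (simp add: sum_distrib_left)
  then have "c = 1" using m(2) optimal_strategy_simplex(2) by simp
  then show ?thesis using mc by simp
qed

lemma optimal_strategy_no_condorcet: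
  assumes "\<nexists>c. condorcet_winner T c"
  shows "p $ b < 1"
proof (rule ccontr)
  assume "\<not> p $ b < 1"
  have "(\<Sum>x\<in>UNIV. p $ x) = p $ b + (\<Sum>x\<in>UNIV - {b}. p $ x)"
    by (simp add: sum.remove)
  moreover have "0 \<le> (\<Sum>x\<in>UNIV - {b}. p $ x)"
    by (intro sum_nonneg optimal_strategy_simplex)
  ultimately have "p $ b = 1" and "(\<Sum>x\<in>UNIV - {b}. p $ x) = 0"
    using \<open>\<not> p $ b < 1\<close> optimal_strategy_simplex(2) by auto
  then have 0: "p $ x = 0" if "x \<noteq> b" for x
    using that by (subst (asm) sum_nonneg_eq_0_iff) (auto intro: optimal_strategy_simplex)
  have "T b y" if "y \<noteq> b" for y
  proof -
    have "advantage T y p = (\<Sum>x\<in>UNIV. if x = b then payoff T y b else 0)"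
      unfolding advantage_def using 0 \<open>p $ b = 1\<close> by (intro sum.cong) auto
    then have "payoff T y b < 0"
      using advantage_optimal_outside[OF 0[OF that]] by simp
    then show ?thesis using that T by (auto simp: payoff_def tournament_def split: if_splits)
  qed
  then show False using assms by (auto simp: condorcet_winner_def)
qed

end

section \<open>One step of the reinforcement process\<close>

definition total :: "('a::finite \<Rightarrow> nat) \<Rightarrow> nat" where
  "total n = (\<Sum>y\<in>UNIV. n y)"

abbreviation add_ball :: "'a \<Rightarrow> ('a \<Rightarrow> nat) \<Rightarrow> 'a \<Rightarrow> nat" where
  "add_ball x n \<equiv> n(x := Suc (n x))"

text \<open>
  The probability that a ball of colour \<open>x\<close> is added: with \<open>b\<close> the proportion of the colours
  beaten by \<open>x\<close> it is \<open>m(x) (m(x) + 2 b)\<close>, and the payoff of \<open>x\<close> against \<open>m\<close> is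
  \<open>m(x) + 2 b - 1\<close>.
\<close>
definition pick_prob :: "('a::finite \<Rightarrow> 'a \<Rightarrow> bool) \<Rightarrow> ('a \<Rightarrow> nat) \<Rightarrow> 'a \<Rightarrow> real" where
  "pick_prob T n x = composition n $ x * (1 + advantage T x (composition n))"

lemma composition_nth: "composition n $ x = real (n x) / real (total n)"
  by (simp add: composition_def total_def)

lemma urn_add_ball: "urn n \<Longrightarrow> urn (add_ball x n)"
  by (simp add: urn_def)

lemma total_add_ball: "total (add_ball x n) = Suc (total n)"
  by (simp add: total_def fun_upd_def sum.If_cases Compl_eq_Diff_UNIV sum.remove[of UNIV x])

lemma le_total: "n x \<le> total n"
  unfolding total_def by (rule member_le_sum) auto

lemma total_pos: "urn n \<Longrightarrow> 0 < total n"
  using le_total[of n undefined] by (metis urn_def gr0I leD)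

lemma composition_pos: "urn n \<Longrightarrow> 0 < composition n $ x"
  using total_pos[of n] by (simp add: composition_nth urn_def)

lemma composition_le_1: "composition n $ x \<le> 1"
  using le_total[of n x] by (cases "total n = 0") (simp_all add: composition_nth)

lemma sum_composition: "urn n \<Longrightarrow> (\<Sum>x\<in>UNIV. composition n $ x) = 1"
  using composition_in_prob_simplex by (auto simp: prob_simplex_def)

lemma composition_add_ball:
  assumes "urn n"
  shows "composition (add_ball x n) $ y
    = composition n $ y + (of_bool (x = y) - composition n $ y) / (real (total n) + 1)"
proof -
  have S: "0 < real (total n)" "0 < real (total n) + 1" using total_pos[OF assms] by auto
  show ?thesis
    unfolding composition_nth total_add_ball of_nat_Suc add.commute[of 1]
    using S by (auto simp: divide_simps) (simp_all add: algebra_simps)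
qed

lemma abs_advantage_le:
  assumes "urn n"
  shows "\<bar>advantage T x (composition n)\<bar> \<le> 1"
proof -
  have "\<bar>advantage T x (composition n)\<bar> \<le> (\<Sum>y\<in>UNIV. \<bar>payoff T x y * composition n $ y\<bar>)"
    unfolding advantage_def by (rule sum_abs)
  also have "\<dots> \<le> (\<Sum>y\<in>UNIV. composition n $ y)"
    using composition_pos[OF assms] abs_payoff_le[of T x]
    by (intro sum_mono) (auto simp: abs_mult less_imp_le intro: mult_left_le_one_le)
  finally show ?thesis by (simp add: sum_composition[OF assms])
qed

lemma pick_prob_bounds:
  assumes "urn n"
  shows "0 \<le> pick_prob T n x" "pick_prob T n x \<le> 2 * composition n $ x"
  using abs_advantage_le[OF assms, of T x] composition_pos[OF assms, of x]
  by (auto simp: pick_prob_def abs_le_iff)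

lemma sum_pick_prob:
  assumes "tournament T" "urn n"
  shows "(\<Sum>x\<in>UNIV. pick_prob T n x) = 1"
  using advantage_skew[OF assms(1), of "composition n" "composition n"] sum_composition[OF assms(2)]
  by (simp add: pick_prob_def distrib_left sum.distrib)

text \<open>
  The mean field of the process is the replicator vector field \<open>m(y) g(y, m)\<close>, divided by the
  number of balls.
\<close>
lemma expected_composition:
  assumes "tournament T" "urn n"
  shows "(\<Sum>x\<in>UNIV. pick_prob T n x * composition (add_ball x n) $ y)
    = composition n $ y + composition n $ y * advantage T y (composition n) / (real (total n) + 1)"
proof -
  let ?m = "composition n $ y" and ?S = "real (total n) + 1"
  have "(\<Sum>x\<in>UNIV. pick_prob T n x * composition (add_ball x n) $ y)
      = (\<Sum>x\<in>UNIV. pick_prob T n x * (?m - ?m / ?S) + (if x = y then pick_prob T n y / ?S else 0))"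
    by (intro sum.cong refl)
      (auto simp: composition_add_ball[OF assms(2)] algebra_simps diff_divide_distrib add_divide_distrib)
  also have "\<dots> = (?m - ?m / ?S) + pick_prob T n y / ?S"
    by (simp add: sum.distrib sum_distrib_right[symmetric] sum_pick_prob[OF assms])
  also have "\<dots> = ?m + ?m * advantage T y (composition n) / ?S"
    by (simp add: pick_prob_def distrib_left add_divide_distrib)
  finally show ?thesis .
qed

section \<open>Entropy and harmonic sums\<close>

text \<open>
  A version of the logarithm whose increment at \<open>n\<close> is exactly \<open>1 / n\<close>. With it the drift of the
  potential below has no error terms, even when some colours are rare.
\<close>
definition harm_below :: "nat \<Rightarrow> real" where
  "harm_below n = (\<Sum>k = 1..<n. 1 / real k)"

definition harm_log_gap :: "nat \<Rightarrow> real" where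
  "harm_log_gap n = harm_below n - ln (real n)"

lemma harm_below_Suc: "harm_below (Suc n) = harm_below n + 1 / real n"
  by (cases "n = 0") (simp_all add: harm_below_def)

text \<open>
  The trapezoidal rule overestimates the integral of the convex function \<open>1 / t\<close>; the resulting
  bounds telescope.
\<close>
lemma harm_log_gap_increment:
  assumes "1 \<le> a" "a \<le> b"
  shows "(1 / real a - 1 / real b) / 2 \<le> harm_log_gap b - harm_log_gap a"
  using assms(2)
proof (induction b rule: dec_induct)
  case (step b)
  have "ln (real b + 1) - ln (real b) \<le> (1 / real b + 1 / (real b + 1)) / 2"
    using ln_inverse_approx_le[of "real b" 1] step assms by (simp add: inverse_eq_divide)
  then have "(1 / real b - 1 / real (Suc b)) / 2 \<le> harm_log_gap (Suc b) - harm_log_gap b"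
    unfolding harm_log_gap_def harm_below_Suc of_nat_Suc by (simp add: add.commute)
  then show ?case using step.IH by argo
qed simp

lemma harm_log_gap_mono: "1 \<le> a \<Longrightarrow> a \<le> b \<Longrightarrow> harm_log_gap a \<le> harm_log_gap b"
  using harm_log_gap_increment[of a b] frac_le[of 1 1 "real a" "real b"] by simp

lemma harm_log_gap_tendsto: "harm_log_gap \<longlonglongrightarrow> euler_mascheroni"
proof -
  have "harm_log_gap n = harm n - ln (real n) - 1 / real n" for n
  proof (cases n)
    case (Suc k)
    then show ?thesis
      unfolding harm_log_gap_def harm_below_def harm_def
      by (simp add: inverse_eq_divide atLeastLessThanSuc_atLeastAtMost)
  qed (simp add: harm_log_gap_def harm_below_def harm_def)
  then have "harm_log_gap = (\<lambda>n. harm n - ln (real n) - 1 / real n)" by blast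
  moreover have "(\<lambda>n. harm n - ln (real n) - 1 / real n) \<longlonglongrightarrow> euler_mascheroni - 0"
    by (intro tendsto_diff euler_mascheroni_LIMSEQ lim_1_over_n)
  ultimately show ?thesis unfolding diff_zero by (simp only:)
qed

text \<open>
  The relative entropy of \<open>p\<close> with respect to \<open>m\<close>. The summands with \<open>p $ x = 0\<close> vanish, whatever
  value the logarithm is given there.
\<close>
definition rel_entropy :: "real ^ 'a::finite \<Rightarrow> real ^ 'a \<Rightarrow> real" where
  "rel_entropy p m = (\<Sum>x\<in>UNIV. p $ x * (ln (p $ x) - ln (m $ x)))"

text \<open>
  The squared Hellinger distance is a convenient lower bound because it controls also the colours outside the
  support of \<open>p\<close>. It follows from \<open>ln u \<le> u - 1\<close> for \<open>u = sqrt (m x / p x)\<close>.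
\<close>
lemma rel_entropy_ge_hellinger:
  assumes p: "\<And>x. 0 \<le> p $ x" "(\<Sum>x\<in>UNIV. p $ x) = 1"
    and m: "\<And>x. 0 \<le> m $ x" "(\<Sum>x\<in>UNIV. m $ x) = 1"
    and pm: "\<And>x. 0 < p $ x \<Longrightarrow> 0 < m $ x"
  shows "(\<Sum>x\<in>UNIV. (sqrt (p $ x) - sqrt (m $ x))\<^sup>2) \<le> rel_entropy p m"
proof -
  have *: "2 * p $ x - 2 * (sqrt (p $ x) * sqrt (m $ x)) \<le> p $ x * (ln (p $ x) - ln (m $ x))" for x
  proof (cases "p $ x = 0")
    case False
    then have "0 < p $ x" using p(1)[of x] by simp
    with pm have "0 < m $ x" by simp
    let ?u = "sqrt (m $ x) / sqrt (p $ x)"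
    have "ln ?u \<le> ?u - 1"
      using \<open>0 < p $ x\<close> \<open>0 < m $ x\<close> by (intro ln_le_minus_one) simp
    moreover have "ln ?u = (ln (m $ x) - ln (p $ x)) / 2"
      using \<open>0 < p $ x\<close> \<open>0 < m $ x\<close> by (simp add: ln_div ln_sqrt diff_divide_distrib)
    ultimately have "2 - 2 * ?u \<le> ln (p $ x) - ln (m $ x)" by simp
    then have "p $ x * (2 - 2 * ?u) \<le> p $ x * (ln (p $ x) - ln (m $ x))"
      using \<open>0 < p $ x\<close> by (intro mult_left_mono) simp_all
    moreover have "p $ x * ?u = sqrt (p $ x) * sqrt (m $ x)"
      using \<open>0 < p $ x\<close> by (simp add: field_simps)
    ultimately show ?thesis unfolding right_diff_distrib by linarith
  qed simp
  have "(\<Sum>x\<in>UNIV. (sqrt (p $ x) - sqrt (m $ x))\<^sup>2)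
      = (\<Sum>x\<in>UNIV. p $ x + m $ x - 2 * (sqrt (p $ x) * sqrt (m $ x)))"
    using p(1) m(1) by (simp add: power2_diff mult.assoc)
  also have "\<dots> = (\<Sum>x\<in>UNIV. 2 * p $ x - 2 * (sqrt (p $ x) * sqrt (m $ x)))"
    using p(2) m(2) by (simp add: sum_subtractf sum.distrib sum_distrib_left[symmetric])
  also have "\<dots> \<le> rel_entropy p m"
    unfolding rel_entropy_def by (intro sum_mono *)
  finally show ?thesis .
qed

context tournament_game
begin

text \<open>
  The relative entropy of \<open>p\<close> with respect to the composition, in which the logarithms of the numbers of
  balls are replaced by harmonic sums.
\<close>
definition potential :: "('a \<Rightarrow> nat) \<Rightarrow> real" where
  "potential n = harm_below (total n) - (\<Sum>x\<in>UNIV. p $ x * harm_below (n x)) + (\<Sum>x\<in>UNIV. p $ x * ln (p $ x))"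

text \<open>
  The potential is the relative entropy plus a correction caused by the discreteness of the urn. The
  correction is non-negative and vanishes in the limit where the colours of the support have many balls.
\<close>
lemma potential_eq_rel_entropy:
  assumes "urn n"
  shows "potential n = rel_entropy p (composition n)
     + (\<Sum>x\<in>UNIV. p $ x * (harm_log_gap (total n) - harm_log_gap (n x)))"
proof -
  have ln: "ln (composition n $ x) = ln (n x) - ln (total n)" for x
    using assms total_pos[OF assms] by (simp add: composition_nth ln_div urn_def)
  have "rel_entropy p (composition n) + (\<Sum>x\<in>UNIV. p $ x * (harm_log_gap (total n) - harm_log_gap (n x)))
      = (\<Sum>x\<in>UNIV. p $ x * harm_below (total n) - p $ x * harm_below (n x) + p $ x * ln (p $ x))"
    unfolding rel_entropy_def sum.distrib[symmetric]
    by (intro sum.cong refl) (simp add: ln harm_log_gap_def algebra_simps)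
  also have "\<dots> = potential n"
    by (simp add: potential_def sum.distrib sum_subtractf sum_distrib_right[symmetric]
        optimal_strategy_simplex)
  finally show ?thesis ..
qed

lemma rel_entropy_le_potential:
  assumes "urn n"
  shows "rel_entropy p (composition n) \<le> potential n"
  unfolding potential_eq_rel_entropy[OF assms]
  using assms by (auto intro!: sum_nonneg mult_nonneg_nonneg optimal_strategy_simplex harm_log_gap_mono le_total
      simp: urn_def Suc_le_eq)

lemma hellinger_le_potential:
  assumes "urn n"
  shows "(\<Sum>x\<in>UNIV. (sqrt (p $ x) - sqrt (composition n $ x))\<^sup>2) \<le> potential n"
proof -
  have "(\<Sum>x\<in>UNIV. (sqrt (p $ x) - sqrt (composition n $ x))\<^sup>2) \<le> rel_entropy p (composition n)"
    by (rule rel_entropy_ge_hellinger)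
       (auto simp: optimal_strategy_simplex sum_composition assms composition_pos less_imp_le)
  with rel_entropy_le_potential[OF assms] show ?thesis by simp
qed

lemma potential_nonneg: "urn n \<Longrightarrow> 0 \<le> potential n"
  by (rule order_trans[OF sum_nonneg hellinger_le_potential]) auto

lemma potential_add_ball:
  "potential (add_ball x n) = potential n + (1 / real (total n) - p $ x / real (n x))"
proof -
  have "(\<Sum>y\<in>UNIV. p $ y * harm_below ((add_ball x n) y))
      = (\<Sum>y\<in>UNIV. p $ y * harm_below (n y) + (if y = x then p $ x / real (n x) else 0))"
    by (intro sum.cong refl) (auto simp: harm_below_Suc algebra_simps)
  then show ?thesis
    by (simp add: potential_def total_add_ball harm_below_Suc sum.distrib)
qed

text \<open>
  The expected decrease of the potential in one step. Only colours outside the support of \<open>p\<close>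
  contribute.
\<close>
definition dissipation :: "('a \<Rightarrow> nat) \<Rightarrow> real" where
  "dissipation n = (\<Sum>y\<in>UNIV. composition n $ y * - advantage T y p) / real (total n)"

lemma dissipation_nonneg: "0 \<le> dissipation n"
  unfolding dissipation_def composition_nth
  by (intro divide_nonneg_nonneg sum_nonneg mult_nonneg_nonneg) (auto simp: advantage_optimal_le)

text \<open>
  By skew-symmetry the drift of the potential, which is an average of payoffs against \<open>m\<close> weighted by
  \<open>p\<close>, equals an average of payoffs against \<open>p\<close> weighted by \<open>m\<close>.
\<close>
lemma expected_potential:
  assumes "urn n"
  shows "(\<Sum>x\<in>UNIV. pick_prob T n x * potential (add_ball x n)) = potential n - dissipation n"
proof -
  have *: "pick_prob T n x * (p $ x / real (n x))
      = (p $ x + p $ x * advantage T x (composition n)) / real (total n)" for x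
  proof -
    have "composition n $ x / real (n x) = 1 / real (total n)"
      using assms by (simp add: composition_nth urn_def)
    moreover have "pick_prob T n x * (p $ x / real (n x))
        = composition n $ x / real (n x) * (p $ x * (1 + advantage T x (composition n)))"
      by (simp add: pick_prob_def mult_ac)
    ultimately have "pick_prob T n x * (p $ x / real (n x))
        = 1 / real (total n) * (p $ x * (1 + advantage T x (composition n)))"
      by presburger
    then show ?thesis by (simp add: distrib_left add_divide_distrib)
  qed
  have "(\<Sum>x\<in>UNIV. pick_prob T n x * (p $ x / real (n x)))
      = (1 + (\<Sum>x\<in>UNIV. p $ x * advantage T x (composition n))) / real (total n)"
    unfolding * sum_divide_distrib[symmetric] sum.distrib optimal_strategy_simplex ..
  also have "\<dots> = 1 / real (total n) + dissipation n"
    unfolding advantage_skew[OF T, of p] dissipation_def by (simp add: sum_negf add_divide_distrib diff_divide_distrib)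
  finally have "(\<Sum>x\<in>UNIV. pick_prob T n x * (p $ x / real (n x)))
     = 1 / real (total n) + dissipation n" .
  then show ?thesis
    using sum_pick_prob[OF T assms]
    by (simp add: potential_add_ball distrib_left right_diff_distrib sum.distrib sum_subtractf
        sum_distrib_right[symmetric] del: times_divide_eq_right)
qed

section \<open>A submartingale near the optimal strategy\<close>

text \<open>
  One constant that serves both as a lower bound for the positive weights of \<open>p\<close> and as a lower
  bound for the loss of the other colours against \<open>p\<close>.
\<close>
definition gap :: real where
  "gap = Min (range (\<lambda>x. if 0 < p $ x then p $ x else - advantage T x p))"

lemma gap_pos: "0 < gap"
  unfolding gap_def using optimal_strategy_simplex(1) advantage_optimal_outside
  by (subst Min_gr_iff) (auto simp: less_le)

lemma gap_le_support: "0 < p $ x \<Longrightarrow> gap \<le> p $ x"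
  unfolding gap_def by (rule Min.coboundedI) (auto intro!: image_eqI[where x = x])

lemma advantage_le_gap:
  assumes "p $ x = 0" shows "advantage T x p \<le> - gap"
proof -
  have "gap \<le> - advantage T x p"
    unfolding gap_def by (rule Min.coboundedI) (auto intro!: image_eqI[where x = x] simp: assms)
  then show ?thesis by simp
qed

definition outside :: "('a \<Rightarrow> nat) \<Rightarrow> real" where
  "outside n = (\<Sum>y | p $ y = 0. composition n $ y)"

text \<open>
  Near \<open>p\<close> the term \<open>36 D / S\<close> pays for the variance of the future increments of the potential
  \<open>D\<close>, and the multiple of the outside mass pays for its future dissipation. The parameter \<open>l\<close>
  is an inverse scale: the barrier is positive only where \<open>D < 1 / l\<close>.
\<close>
definition barrier :: "real \<Rightarrow> ('a \<Rightarrow> nat) \<Rightarrow> real" where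
  "barrier l n = potential n - l * ((potential n)\<^sup>2 + 36 * potential n / real (total n))
     - 4 / gap * outside n"

text \<open>
  For \<open>near \<le> l\<close>, a potential below \<open>1 / l\<close> forces \<open>m(x) \<ge> p(x) / 4\<close> everywhere (first
  summand) and makes every colour outside the support lose at least \<open>gap / 2\<close> against \<open>m\<close>
  (second summand).
\<close>
definition near :: real where
  "near = 4 / gap + (4 * real CARD('a) / gap)\<^sup>2"

lemma outside_nonneg: "0 \<le> outside n"
  by (auto simp: outside_def composition_nth intro!: sum_nonneg)

lemma barrier_le_potential: "urn n \<Longrightarrow> 0 \<le> l \<Longrightarrow> barrier l n \<le> potential n"
proof -
  assume "urn n" "0 \<le> l"
  then have "0 \<le> l * ((potential n)\<^sup>2 + 36 * potential n / real (total n))"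
    and "0 \<le> 4 / gap * outside n"
    using outside_nonneg[of n] potential_nonneg[of n] gap_pos by auto
  then show ?thesis unfolding barrier_def by linarith
qed

lemma near_pos: "0 < near"
  using gap_pos by (simp add: near_def add_pos_nonneg)

lemma barrier_pos_imp:
  assumes "urn n" "0 < l" "0 < barrier l n"
  shows "potential n < 1 / l"
proof -
  have D: "0 \<le> potential n" by (rule potential_nonneg[OF assms(1)])
  have "0 \<le> l * (36 * potential n / real (total n)) + 4 / gap * outside n"
    using D assms(2) gap_pos outside_nonneg[of n]
    by (intro add_nonneg_nonneg mult_nonneg_nonneg divide_nonneg_nonneg) auto
  then have "0 < potential n * (1 - l * potential n)"
    using assms(3) by (simp add: barrier_def power2_eq_square algebra_simps)
  then have "0 < 1 - l * potential n" using D by (auto simp: zero_less_mult_iff)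
  then show ?thesis using assms(2) by (simp add: field_simps)
qed

lemma barrier_le:
  assumes "urn n" "0 < l"
  shows "barrier l n \<le> 1 / l"
  using barrier_pos_imp[OF assms] barrier_le_potential[OF assms(1), of l] assms(2)
  by (cases "0 < barrier l n") (auto intro: order_trans[of _ 0])

lemma sqrt_close:
  assumes "urn n" "near \<le> l" "potential n < 1 / l"
  shows "\<bar>sqrt (p $ x) - sqrt (composition n $ x)\<bar> \<le> sqrt (1 / l)"
proof -
  have "(sqrt (p $ x) - sqrt (composition n $ x))\<^sup>2
      \<le> (\<Sum>x\<in>UNIV. (sqrt (p $ x) - sqrt (composition n $ x))\<^sup>2)"
    by (intro member_le_sum) auto
  also have "\<dots> \<le> 1 / l" using hellinger_le_potential[OF assms(1)] assms(3) by simp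
  finally show ?thesis
    using real_sqrt_le_mono by fastforce
qed

text \<open>
  The expected squared increment is at most twice the chi-square distance \<open>\<Sum> (m - p)^2 / m\<close> divided
  by \<open>S^2\<close>. Where \<open>m \<ge> p / 4\<close> this distance is comparable to the squared Hellinger
  distance, hence bounded by the potential.
\<close>
lemma expected_sq_increment:
  assumes n: "urn n" and l: "near \<le> l" and small: "potential n < 1 / l"
  shows "(\<Sum>x\<in>UNIV. pick_prob T n x * (1 / real (total n) - p $ x / real (n x))\<^sup>2)
     \<le> 18 * potential n / (real (total n))\<^sup>2"
proof -
  have l0: "0 < l" using near_pos l by simp
  have *: "pick_prob T n x * (1 / real (total n) - p $ x / real (n x))\<^sup>2
     \<le> 18 * (sqrt (p $ x) - sqrt (composition n $ x))\<^sup>2 / (real (total n))\<^sup>2" for x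
  proof -
    define m where "m = composition n $ x"
    define S where "S = real (total n)"
    have m: "0 < m" using composition_pos[OF n] by (simp add: m_def)
    have S: "0 < S" using total_pos[OF n] by (simp add: S_def)
    have p0: "0 \<le> p $ x" by (rule optimal_strategy_simplex)
    have "1 / S - p $ x / real (n x) = (m - p $ x) / (m * S)"
      using S n by (simp add: m_def S_def composition_nth urn_def field_simps)
    then have eq: "(1 / S - p $ x / real (n x))\<^sup>2 = (m - p $ x)\<^sup>2 / (m\<^sup>2 * S\<^sup>2)"
      by (simp add: power_divide power_mult_distrib)
    have "sqrt (p $ x) \<le> 2 * sqrt m"
    proof (cases "p $ x = 0")
      case False
      then have "gap \<le> p $ x" using gap_le_support p0 by simp
      have "4 / gap \<le> l" using l by (simp add: near_def) (smt (verit) zero_le_power2)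
      then have "1 / l \<le> gap / 4" using gap_pos l0 by (simp add: field_simps)
      then have "1 / l \<le> p $ x / 4" using \<open>gap \<le> p $ x\<close> by simp
      then have "sqrt (1 / l) \<le> sqrt (p $ x / 4)" by (rule real_sqrt_le_mono)
      then have "sqrt (1 / l) \<le> sqrt (p $ x) / 2" by (simp add: real_sqrt_divide)
      then show ?thesis using sqrt_close[OF n l small, of x] by (simp add: m_def abs_le_iff)
    qed (use m in simp)
    then have "(sqrt (p $ x) + sqrt m)\<^sup>2 \<le> (3 * sqrt m)\<^sup>2"
      using p0 m by (intro power_mono) auto
    also have "\<dots> = 9 * m" using m by (simp add: power_mult_distrib)
    finally have 9: "(sqrt (p $ x) + sqrt m)\<^sup>2 \<le> 9 * m" .
    have "m - p $ x = (sqrt m - sqrt (p $ x)) * (sqrt (p $ x) + sqrt m)"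
      using m p0 by (simp add: algebra_simps)
    then have "(m - p $ x)\<^sup>2 = (sqrt (p $ x) - sqrt m)\<^sup>2 * (sqrt (p $ x) + sqrt m)\<^sup>2"
      by (simp add: power_mult_distrib power2_commute)
    also have "\<dots> \<le> (sqrt (p $ x) - sqrt m)\<^sup>2 * (9 * m)"
      using 9 by (rule mult_left_mono) simp
    finally have chi: "(m - p $ x)\<^sup>2 \<le> (sqrt (p $ x) - sqrt m)\<^sup>2 * (9 * m)" .
    have "pick_prob T n x * (1 / S - p $ x / real (n x))\<^sup>2
        \<le> 2 * m * ((m - p $ x)\<^sup>2 / (m\<^sup>2 * S\<^sup>2))"
      unfolding eq using pick_prob_bounds[OF n, of T x]
      by (intro mult_right_mono) (auto simp: m_def)
    also have "\<dots> \<le> 2 * m * (((sqrt (p $ x) - sqrt m)\<^sup>2 * (9 * m)) / (m\<^sup>2 * S\<^sup>2))"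
      using chi m by (intro mult_left_mono divide_right_mono) auto
    also have "\<dots> = 18 * (sqrt (p $ x) - sqrt m)\<^sup>2 / S\<^sup>2"
      using m S by (simp add: power2_eq_square)
    finally show ?thesis by (simp add: m_def S_def)
  qed
  have "(\<Sum>x\<in>UNIV. pick_prob T n x * (1 / real (total n) - p $ x / real (n x))\<^sup>2)
      \<le> (\<Sum>x\<in>UNIV. 18 * (sqrt (p $ x) - sqrt (composition n $ x))\<^sup>2 / (real (total n))\<^sup>2)"
    by (intro sum_mono *)
  also have "\<dots> = 18 * (\<Sum>x\<in>UNIV. (sqrt (p $ x) - sqrt (composition n $ x))\<^sup>2) / (real (total n))\<^sup>2"
    by (simp add: sum_distrib_left sum_divide_distrib)
  also have "\<dots> \<le> 18 * potential n / (real (total n))\<^sup>2"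
    using hellinger_le_potential[OF n] by (intro divide_right_mono mult_left_mono) auto
  finally show ?thesis .
qed

lemma advantage_outside_near:
  assumes n: "urn n" and l: "near \<le> l" and small: "potential n < 1 / l" and y: "p $ y = 0"
  shows "advantage T y (composition n) \<le> - gap / 2"
proof -
  have l0: "0 < l" using near_pos l by simp
  let ?m = "composition n"
  have "\<bar>?m $ x - p $ x\<bar> \<le> 2 * sqrt (1 / l)" for x
  proof -
    have m: "0 \<le> ?m $ x" "?m $ x \<le> 1" using composition_pos[OF n, of x] composition_le_1[of n x] by auto
    have p0: "0 \<le> p $ x" by (rule optimal_strategy_simplex)
    have "p $ x \<le> (\<Sum>x\<in>UNIV. p $ x)"
      by (intro member_le_sum optimal_strategy_simplex) auto
    then have p1: "p $ x \<le> 1" by (simp add: optimal_strategy_simplex)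
    have "?m $ x - p $ x = (sqrt (?m $ x) - sqrt (p $ x)) * (sqrt (p $ x) + sqrt (?m $ x))"
      using m p0 by (simp add: algebra_simps)
    then have "\<bar>?m $ x - p $ x\<bar>
       = \<bar>sqrt (p $ x) - sqrt (?m $ x)\<bar> * (sqrt (p $ x) + sqrt (?m $ x))"
      using m p0 by (simp add: abs_mult abs_minus_commute)
    also have "\<dots> \<le> sqrt (1 / l) * 2"
    proof (intro mult_mono sqrt_close[OF n l small])
      show "sqrt (p $ x) + sqrt (?m $ x) \<le> 2"
        using real_sqrt_le_mono[OF p1] real_sqrt_le_mono[OF m(2)] unfolding real_sqrt_one by linarith
    qed (use m p0 l0 in auto)
    finally show ?thesis by simp
  qed note close = this
  have "advantage T y ?m - advantage T y p = (\<Sum>x\<in>UNIV. payoff T y x * (?m $ x - p $ x))"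
    by (simp add: advantage_def sum_subtractf right_diff_distrib)
  also have "\<dots> \<le> (\<Sum>x\<in>UNIV. \<bar>?m $ x - p $ x\<bar>)"
  proof (intro sum_mono)
    fix x
    have "payoff T y x * (?m $ x - p $ x) \<le> \<bar>payoff T y x\<bar> * \<bar>?m $ x - p $ x\<bar>"
      by (metis abs_ge_self abs_mult)
    also have "\<dots> \<le> 1 * \<bar>?m $ x - p $ x\<bar>" by (intro mult_right_mono abs_payoff_le) auto
    finally show "payoff T y x * (?m $ x - p $ x) \<le> \<bar>?m $ x - p $ x\<bar>" by simp
  qed
  also have "\<dots> \<le> (\<Sum>x\<in>(UNIV::'a set). 2 * sqrt (1 / l))" by (intro sum_mono close)
  also have "\<dots> = 2 * real CARD('a) * sqrt (1 / l)" by simp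
  also have "\<dots> \<le> gap / 2"
  proof -
    have "(4 * real CARD('a) / gap)\<^sup>2 \<le> l" using l gap_pos by (simp add: near_def) (smt (verit) divide_nonneg_pos)
    then have "4 * real CARD('a) / gap \<le> sqrt l" by (rule real_le_rsqrt)
    then show ?thesis using gap_pos l0 by (simp add: real_sqrt_divide field_simps)
  qed
  finally show ?thesis using advantage_le_gap[OF y] by simp
qed

lemma expected_outside:
  assumes n: "urn n" and l: "near \<le> l" and small: "potential n < 1 / l"
  shows "(\<Sum>x\<in>UNIV. pick_prob T n x * outside (add_ball x n))
     \<le> outside n - gap / 2 * outside n / (real (total n) + 1)"
proof -
  have "(\<Sum>x\<in>UNIV. pick_prob T n x * outside (add_ball x n))
      = (\<Sum>y | p $ y = 0. \<Sum>x\<in>UNIV. pick_prob T n x * composition (add_ball x n) $ y)"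
    unfolding outside_def sum_distrib_left by (rule sum.swap)
  also have "\<dots> \<le> (\<Sum>y | p $ y = 0. composition n $ y - gap / 2 * composition n $ y / (real (total n) + 1))"
  proof (intro sum_mono)
    fix y assume "y \<in> {y. p $ y = 0}"
    then have "composition n $ y * advantage T y (composition n) \<le> composition n $ y * (- gap / 2)"
      using composition_pos[OF n, of y]
      by (intro mult_left_mono advantage_outside_near[OF n l small]) auto
    then have "composition n $ y * advantage T y (composition n) / (real (total n) + 1)
        \<le> composition n $ y * (- gap / 2) / (real (total n) + 1)"
      by (intro divide_right_mono) auto
    then show "(\<Sum>x\<in>UNIV. pick_prob T n x * composition (add_ball x n) $ y)
        \<le> composition n $ y - gap / 2 * composition n $ y / (real (total n) + 1)"
      unfolding expected_composition[OF T n] by (simp add: algebra_simps)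
  qed
  also have "\<dots> = outside n - gap / 2 * outside n / (real (total n) + 1)"
    by (simp add: outside_def sum_subtractf sum_distrib_left sum_divide_distrib)
  finally show ?thesis .
qed

lemma dissipation_le_outside: "dissipation n \<le> outside n / real (total n)"
proof -
  have "composition n $ y * - advantage T y p \<le> (if p $ y = 0 then composition n $ y else 0)" for y
  proof (cases "p $ y = 0")
    case True
    have "- advantage T y p \<le> (\<Sum>x\<in>UNIV. p $ x)"
      unfolding advantage_def sum_negf[symmetric]
    proof (intro sum_mono)
      fix x
      have "- payoff T y x * p $ x \<le> 1 * p $ x"
        using abs_payoff_le[of T y x] by (intro mult_right_mono optimal_strategy_simplex) linarith
      then show "- (payoff T y x * p $ x) \<le> p $ x" by simp
    qed
    then show ?thesis
      using True mult_left_mono[of "- advantage T y p" 1 "composition n $ y"]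
      by (simp add: optimal_strategy_simplex composition_nth)
  next
    case False
    then show ?thesis
      using advantage_optimal_support[of y] optimal_strategy_simplex(1)[of y] by simp
  qed
  then have "(\<Sum>y\<in>UNIV. composition n $ y * - advantage T y p) \<le> outside n"
    unfolding outside_def sum.inter_filter[OF finite_class.finite_UNIV, simplified] by (rule sum_mono)
  then show ?thesis unfolding dissipation_def by (rule divide_right_mono) simp
qed

text \<open>
  Taking the positive part makes the property global, without any stopping time: where the
  barrier is not positive there is nothing to prove, and where it is positive the urn
  is close to \<open>p\<close>.
\<close>
lemma barrier_submartingale:
  assumes n: "urn n" and l: "near \<le> l"
  shows "max 0 (barrier l n) \<le> (\<Sum>x\<in>UNIV. pick_prob T n x * max 0 (barrier l (add_ball x n)))"
proof (cases "0 < barrier l n")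
  case False
  then show ?thesis
    by (auto intro!: sum_nonneg mult_nonneg_nonneg pick_prob_bounds(1)[OF n] simp: max_def)
next
  case True
  define D where "D = potential n"
  define S where "S = real (total n)"
  define q where "q = pick_prob T n"
  define d where "d = (\<lambda>x. 1 / S - p $ x / real (n x))"
  have l0: "0 < l" using near_pos l by simp
  have small: "potential n < 1 / l" by (rule barrier_pos_imp[OF n l0 True])
  have D0: "0 \<le> D" using potential_nonneg[OF n] by (simp add: D_def)
  have S1: "1 \<le> S" using total_pos[OF n] by (simp add: S_def)
  have q1: "(\<Sum>x\<in>UNIV. q x) = 1" unfolding q_def by (rule sum_pick_prob[OF T n])
  have D': "potential (add_ball x n) = D + d x" for x
    by (simp add: D_def d_def S_def potential_add_ball)
  have qd: "(\<Sum>x\<in>UNIV. q x * d x) = - dissipation n"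
    using expected_potential[OF n] q1 unfolding D' q_def[symmetric] D_def[symmetric]
    by (simp add: distrib_left sum.distrib sum_distrib_right[symmetric])
  have qd2: "(\<Sum>x\<in>UNIV. q x * (d x)\<^sup>2) \<le> 18 * D / S\<^sup>2"
    using expected_sq_increment[OF n l small] by (simp add: q_def d_def D_def S_def)
  have qz: "(\<Sum>x\<in>UNIV. q x * outside (add_ball x n)) \<le> outside n - gap / 2 * outside n / (S + 1)"
    using expected_outside[OF n l small] by (simp add: q_def S_def)
  have e0: "0 \<le> dissipation n" by (rule dissipation_nonneg)
  have e1: "dissipation n \<le> outside n / S" using dissipation_le_outside by (simp add: S_def)
  have z0: "0 \<le> outside n" by (rule outside_nonneg)
  have b': "barrier l (add_ball x n)
     = D + d x - l * (D\<^sup>2 + 2 * D * d x + (d x)\<^sup>2 + 36 / (S + 1) * (D + d x))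
        - 4 / gap * outside (add_ball x n)" for x
    by (simp add: barrier_def D' total_add_ball S_def power2_sum add.commute)
  have "(\<Sum>x\<in>UNIV. q x * barrier l (add_ball x n))
     = (\<Sum>x\<in>UNIV. q x * (D - l * D\<^sup>2 - l * (36 / (S + 1)) * D)
          + q x * d x * (1 - 2 * l * D - l * (36 / (S + 1)))
          - l * (q x * (d x)\<^sup>2) - 4 / gap * (q x * outside (add_ball x n)))"
    unfolding b' by (intro sum.cong refl) (simp only: algebra_simps)
  also have "\<dots> = (D - l * D\<^sup>2 - l * (36 / (S + 1)) * D)
          - dissipation n * (1 - 2 * l * D - l * (36 / (S + 1)))
          - l * (\<Sum>x\<in>UNIV. q x * (d x)\<^sup>2) - 4 / gap * (\<Sum>x\<in>UNIV. q x * outside (add_ball x n))"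
    unfolding sum_subtractf sum.distrib sum_distrib_right[symmetric] sum_distrib_left[symmetric] q1 qd
    by simp
  also have "\<dots> \<ge> (D - l * D\<^sup>2 - l * (36 / (S + 1)) * D)
          - dissipation n
          - l * (18 * D / S\<^sup>2) - 4 / gap * (outside n - gap / 2 * outside n / (S + 1))"
  proof -
    have "dissipation n * (1 - 2 * l * D - l * (36 / (S + 1))) \<le> dissipation n * 1"
    proof (intro mult_left_mono e0)
      have "0 \<le> 2 * l * D" "0 \<le> l * (36 / (S + 1))" using l0 D0 S1 by auto
      then show "1 - 2 * l * D - l * (36 / (S + 1)) \<le> 1" by linarith
    qed
    moreover have "l * (\<Sum>x\<in>UNIV. q x * (d x)\<^sup>2) \<le> l * (18 * D / S\<^sup>2)"
      using l0 qd2 by (intro mult_left_mono) auto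
    moreover have "4 / gap * (\<Sum>x\<in>UNIV. q x * outside (add_ball x n))
       \<le> 4 / gap * (outside n - gap / 2 * outside n / (S + 1))"
      using gap_pos qz by (intro mult_left_mono) auto
    ultimately show ?thesis by simp
  qed
  finally have lower: "(D - l * D\<^sup>2 - l * (36 / (S + 1)) * D) - dissipation n
          - l * (18 * D / S\<^sup>2) - 4 / gap * (outside n - gap / 2 * outside n / (S + 1))
      \<le> (\<Sum>x\<in>UNIV. q x * barrier l (add_ball x n))" .
  \<comment> \<open>The decrease of \<open>36 D / S\<close> from \<open>S\<close> to \<open>S + 1\<close> compensates the variance \<open>18 D / S^2\<close>.\<close>
  have "36 / (S + 1) + 18 / S\<^sup>2 \<le> 36 / S"
  proof -
    have "36 / (S * (2 * S)) \<le> 36 / (S * (S + 1))"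
      using S1 by (intro divide_left_mono mult_left_mono) auto
    moreover have "36 / (S + 1) = 36 / S - 36 / (S * (S + 1))"
      using S1 by (simp add: divide_simps)
    ultimately show ?thesis by (simp add: power2_eq_square)
  qed
  then have "(36 / (S + 1) + 18 / S\<^sup>2) * (l * D) \<le> 36 / S * (l * D)"
    using l0 D0 by (intro mult_right_mono) auto
  then have 1: "l * (36 / (S + 1)) * D + l * (18 * D / S\<^sup>2) \<le> l * (36 * D / S)"
    by (simp add: algebra_simps)
  have "1 / S \<le> 2 / (S + 1)" using S1 by (simp add: field_simps)
  then have "outside n * (1 / S) \<le> outside n * (2 / (S + 1))" by (intro mult_left_mono z0)
  then have 2: "dissipation n \<le> 4 / gap * (gap / 2 * outside n / (S + 1))"
  proof -
    have "4 / gap * (gap / 2 * outside n / (S + 1)) = outside n * (2 / (S + 1))"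
      using gap_pos S1 by (simp add: divide_simps)
    moreover have "dissipation n \<le> outside n * (1 / S)" using e1 by simp
    ultimately show ?thesis using \<open>outside n * (1 / S) \<le> outside n * (2 / (S + 1))\<close> by linarith
  qed
  have "barrier l n = D - l * D\<^sup>2 - l * (36 * D / S) - 4 / gap * outside n"
    by (simp add: barrier_def D_def S_def algebra_simps)
  also have "\<dots> \<le> (\<Sum>x\<in>UNIV. q x * barrier l (add_ball x n))"
    using lower 1 2 unfolding right_diff_distrib by linarith
  also have "\<dots> \<le> (\<Sum>x\<in>UNIV. q x * max 0 (barrier l (add_ball x n)))"
    using pick_prob_bounds(1)[OF n] by (intro sum_mono mult_left_mono) (auto simp: q_def)
  finally show ?thesis using True by (simp add: q_def)
qed

end

section \<open>Finite histories of a Markov chain\<close>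

text \<open>
  The states up to time \<open>t\<close>, most recent state first, so that a step of the chain is a list
  constructor.
\<close>
primrec history :: "(nat \<Rightarrow> 'w \<Rightarrow> 's) \<Rightarrow> nat \<Rightarrow> 'w \<Rightarrow> 's list" where
  "history N 0 \<omega> = [N 0 \<omega>]"
| "history N (Suc t) \<omega> = N (Suc t) \<omega> # history N t \<omega>"

primrec path_pmf :: "('s \<Rightarrow> 's pmf) \<Rightarrow> 's \<Rightarrow> nat \<Rightarrow> 's list pmf" where
  "path_pmf K s0 0 = return_pmf [s0]"
| "path_pmf K s0 (Suc t) = bind_pmf (path_pmf K s0 t) (\<lambda>l. map_pmf (\<lambda>s. s # l) (K (hd l)))"

lemma length_hist [simp]: "length (history N t \<omega>) = Suc t"
  by (induction t) auto

lemma hist_nth: "i \<le> t \<Longrightarrow> history N t \<omega> ! i = N (t - i) \<omega>"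
  by (induction t arbitrary: i) (auto simp: nth_Cons' Suc_diff_le le_Suc_eq split: nat.splits)

lemma hd_hist [simp]: "hd (history N t \<omega>) = N t \<omega>"
  by (cases t) auto

lemma drop_hist: "drop k (history N (t + k) \<omega>) = history N t \<omega>"
  by (induction k) auto

lemma hist_eq_iff:
  "history N t \<omega> = l \<longleftrightarrow> length l = Suc t \<and> (\<forall>i\<le>t. N i \<omega> = l ! (t - i))"
proof
  assume "history N t \<omega> = l"
  then show "length l = Suc t \<and> (\<forall>i\<le>t. N i \<omega> = l ! (t - i))"
    by (auto simp: hist_nth)
next
  assume *: "length l = Suc t \<and> (\<forall>i\<le>t. N i \<omega> = l ! (t - i))"
  show "history N t \<omega> = l"
  proof (rule nth_equalityI)
    fix i assume "i < length (history N t \<omega>)"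
    then show "history N t \<omega> ! i = l ! i" using *[THEN conjunct2, rule_format, of "t - i"] by (simp add: hist_nth)
  qed (use * in simp)
qed

lemma measurable_hist:
  fixes N :: "nat \<Rightarrow> 'w \<Rightarrow> 's :: countable"
  assumes "\<And>t. N t \<in> measurable M (count_space UNIV)"
  shows "history N t \<in> measurable M (count_space UNIV)"
proof (induction t)
  case 0
  have "(\<lambda>\<omega>. [N 0 \<omega>]) \<in> measurable M (count_space UNIV)"
    by (rule measurable_compose[OF assms, of _ _ 0]) simp
  then show ?case by (simp add: history.simps[abs_def])
next
  case (Suc t)
  have "(\<lambda>\<omega>. N (Suc t) \<omega> # history N t \<omega>) \<in> measurable M (count_space UNIV)"
    by (rule measurable_compose_countable[OF _ assms[of "Suc t"]])
       (rule measurable_compose[OF Suc], simp)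
  then show ?case by (simp add: history.simps[abs_def])
qed

lemma pmf_path_Suc:
  "pmf (path_pmf K s0 (Suc t)) (s # l) = pmf (path_pmf K s0 t) l * pmf (K (hd l)) s"
proof -
  have *: "pmf (map_pmf (\<lambda>s. s # l') (K (hd l'))) (s # l) = indicator {l} l' * pmf (K (hd l)) s" for l'
  proof (cases "l' = l")
    case True
    have "pmf (map_pmf (\<lambda>s. s # l) (K (hd l))) (s # l) = pmf (K (hd l)) s"
      by (rule pmf_map_inj') (simp add: inj_def)
    with True show ?thesis by simp
  next
    case False
    then have "s # l \<notin> set_pmf (map_pmf (\<lambda>s. s # l') (K (hd l')))" by auto
    then have "pmf (map_pmf (\<lambda>s. s # l') (K (hd l'))) (s # l) = 0" by (rule pmf_eq_0_set_pmf[THEN iffD2])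
    then show ?thesis using False by simp
  qed
  have "pmf (path_pmf K s0 (Suc t)) (s # l)
     = measure_pmf.expectation (path_pmf K s0 t) (\<lambda>l'. indicator {l} l' * pmf (K (hd l)) s)"
    by (simp add: pmf_bind *)
  then show ?thesis by (simp add: measure_pmf_single)
qed

lemma length_path_pmf: "l \<in> set_pmf (path_pmf K s0 t) \<Longrightarrow> length l = Suc t"
  by (induction t arbitrary: l) auto

lemma finite_path_pmf: "(\<And>s. finite (set_pmf (K s))) \<Longrightarrow> finite (set_pmf (path_pmf K s0 t))"
  by (induction t) auto

locale markov_chain =
  fixes M :: "'w measure" and K :: "'s::countable \<Rightarrow> 's pmf" and s0 :: 's and N :: "nat \<Rightarrow> 'w \<Rightarrow> 's"
  assumes chain: "markov_chain_from M K s0 N" and finite_K: "\<And>s. finite (set_pmf (K s))"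
begin

sublocale prob_space M using chain by (simp add: markov_chain_from_def)

lemma measurable_N [measurable]: "N t \<in> measurable M (count_space UNIV)"
  using chain by (simp add: markov_chain_from_def)

lemma measurable_hist_N [measurable]: "history N t \<in> measurable M (count_space UNIV)"
  by (intro measurable_hist measurable_N)

lemma prob_hist: "prob {\<omega> \<in> space M. history N t \<omega> = l} = pmf (path_pmf K s0 t) l"
proof (induction t arbitrary: l)
  case 0
  have 0: "AE \<omega> in M. N 0 \<omega> = s0" using chain by (simp add: markov_chain_from_def)
  have "prob {\<omega> \<in> space M. history N 0 \<omega> = l} = prob {\<omega> \<in> space M. l = [s0]}"
    by (rule measure_eq_AE) (use 0 in auto)
  also have "\<dots> = pmf (path_pmf K s0 0) l"
    by (cases "l = [s0]") (auto simp: prob_space)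
  finally show ?case .
next
  case (Suc t)
  show ?case
  proof (cases "length l = Suc (Suc t)")
    case False
    then have "l \<notin> set_pmf (path_pmf K s0 (Suc t))" using length_path_pmf[of l K s0 "Suc t"] by auto
    moreover have "{\<omega> \<in> space M. history N (Suc t) \<omega> = l} = {}" using False by fastforce
    ultimately show ?thesis by (metis measure_empty pmf_eq_0_set_pmf)
  next
    case True
    then obtain s l' where l: "l = s # l'" and l': "length l' = Suc t"
      by (metis length_Suc_conv)
    define r where "r = (\<lambda>i. l ! (Suc t - i))"
    have r: "l' ! (t - i) = r i" if "i \<le> t" for i
      using that by (simp add: r_def l Suc_diff_le)
    have hd: "hd l' = r t" using r[of t] l' by (simp add: hd_conv_nth flip: length_greater_0_conv)
    have "prob {\<omega> \<in> space M. history N (Suc t) \<omega> = l} = prob {\<omega> \<in> space M. \<forall>i\<le>Suc t. N i \<omega> = r i}"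
      using True by (simp add: hist_eq_iff r_def del: history.simps)
    also have "\<dots> = prob {\<omega> \<in> space M. \<forall>i\<le>t. N i \<omega> = r i} * pmf (K (r t)) (r (Suc t))"
      using chain unfolding markov_chain_from_def by blast
    also have "prob {\<omega> \<in> space M. \<forall>i\<le>t. N i \<omega> = r i} = prob {\<omega> \<in> space M. history N t \<omega> = l'}"
      using l' r by (simp add: hist_eq_iff)
    also have "\<dots> = pmf (path_pmf K s0 t) l'" by (rule Suc.IH)
    also have "r (Suc t) = s" by (simp add: r_def l)
    finally show ?thesis unfolding l pmf_path_Suc hd .
  qed
qed

text \<open>
  The law of a finite history is discrete with finite support, so all functions of a history are
  integrable and the Markov property becomes the recursion that defines \<open>path_pmf\<close>.
\<close>
lemma distr_hist: "distr M (count_space UNIV) (history N t) = measure_pmf (path_pmf K s0 t)"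
proof (rule measure_eqI_countable[of _ UNIV])
  fix l
  have "emeasure (distr M (count_space UNIV) (history N t)) {l} = emeasure M {\<omega> \<in> space M. history N t \<omega> = l}"
    by (subst emeasure_distr) (auto intro!: arg_cong[where f = "emeasure M"])
  also have "\<dots> = emeasure (measure_pmf (path_pmf K s0 t)) {l}"
    by (simp add: emeasure_eq_measure prob_hist emeasure_pmf_single)
  finally show "emeasure (distr M (count_space UNIV) (history N t)) {l} = emeasure (measure_pmf (path_pmf K s0 t)) {l}" .
qed auto

lemma AE_hist: "AE \<omega> in M. history N t \<omega> \<in> set_pmf (path_pmf K s0 t)"
proof -
  have "AE l in distr M (count_space UNIV) (history N t). l \<in> set_pmf (path_pmf K s0 t)"
    unfolding distr_hist by (rule AE_pmfI) auto
  then show ?thesis by (subst (asm) AE_distr_iff) auto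
qed

lemma integrable_hist [simp, intro]:
  fixes f :: "'s list \<Rightarrow> real"
  shows "integrable M (\<lambda>\<omega>. f (history N t \<omega>))"
proof -
  have "integrable (distr M (count_space UNIV) (history N t)) f"
    unfolding distr_hist by (intro integrable_measure_pmf_finite finite_path_pmf finite_K)
  then show ?thesis by (subst (asm) integrable_distr_eq) auto
qed

lemma integrable_state [simp, intro]:
  fixes f :: "'s \<Rightarrow> real"
  shows "integrable M (\<lambda>\<omega>. f (N t \<omega>))"
  using integrable_hist[of "\<lambda>l. f (hd l)" t] by simp

lemma expectation_hist:
  fixes f :: "'s list \<Rightarrow> real"
  shows "expectation (\<lambda>\<omega>. f (history N t \<omega>)) = measure_pmf.expectation (path_pmf K s0 t) f"
  unfolding distr_hist[symmetric] by (subst integral_distr) auto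

lemma expectation_step:
  fixes g :: "'s list \<Rightarrow> 's \<Rightarrow> real"
  shows "expectation (\<lambda>\<omega>. g (history N t \<omega>) (N (Suc t) \<omega>))
    = expectation (\<lambda>\<omega>. measure_pmf.expectation (K (N t \<omega>)) (g (history N t \<omega>)))"
proof -
  let ?P = "path_pmf K s0 t"
  have fin: "finite (set_pmf ?P)" by (intro finite_path_pmf finite_K)
  have "expectation (\<lambda>\<omega>. g (history N t \<omega>) (N (Suc t) \<omega>))
      = expectation (\<lambda>\<omega>. (\<lambda>l. g (tl l) (hd l)) (history N (Suc t) \<omega>))" by simp
  also have "\<dots> = measure_pmf.expectation (path_pmf K s0 (Suc t)) (\<lambda>l. g (tl l) (hd l))"
    by (rule expectation_hist)
  also have "\<dots> = (\<Sum>l\<in>set_pmf ?P. pmf ?P l *\<^sub>R measure_pmf.expectation (K (hd l)) (g l))"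
    unfolding path_pmf.simps by (subst pmf_expectation_bind[OF fin]) (auto simp: finite_K)
  also have "\<dots> = measure_pmf.expectation ?P (\<lambda>l. measure_pmf.expectation (K (hd l)) (g l))"
    by (rule integral_measure_pmf[OF fin, symmetric]) auto
  also have "\<dots> = expectation (\<lambda>\<omega>. measure_pmf.expectation (K (N t \<omega>)) (g (history N t \<omega>)))"
    unfolding expectation_hist[symmetric] by simp
  finally show ?thesis .
qed

end

section \<open>Consequences of bounded expectations\<close>

text \<open>
  Fatou's lemma. It is applied to the partial sums of the dissipation, to the potential, and
  to normalised squares in the law of large numbers.
\<close>
lemma AE_not_at_top:
  fixes X :: "nat \<Rightarrow> 'w \<Rightarrow> real"
  assumes int: "\<And>t. integrable M (X t)" and pos: "\<And>t. AE \<omega> in M. 0 \<le> X t \<omega>"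
    and bound: "\<And>t. integral\<^sup>L M (X t) \<le> B"
  shows "AE \<omega> in M. \<not> filterlim (\<lambda>t. X t \<omega>) at_top sequentially"
proof -
  have [measurable]: "X t \<in> borel_measurable M" for t using int by auto
  have "(\<integral>\<^sup>+\<omega>. liminf (\<lambda>t. ennreal (X t \<omega>)) \<partial>M) \<le> liminf (\<lambda>t. \<integral>\<^sup>+\<omega>. ennreal (X t \<omega>) \<partial>M)"
    by (rule nn_integral_liminf) simp
  also have "(\<lambda>t. \<integral>\<^sup>+\<omega>. ennreal (X t \<omega>) \<partial>M) = (\<lambda>t. ennreal (integral\<^sup>L M (X t)))"
    by (intro ext nn_integral_eq_integral int pos)
  also have "liminf (\<lambda>t. ennreal (integral\<^sup>L M (X t))) \<le> liminf (\<lambda>t. ennreal B)"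
    by (intro Liminf_mono always_eventually allI ennreal_leI bound)
  also have "\<dots> = ennreal B" by (simp add: Liminf_const)
  finally have "(\<integral>\<^sup>+\<omega>. liminf (\<lambda>t. ennreal (X t \<omega>)) \<partial>M) \<noteq> \<infinity>"
    by (auto simp: top_unique)
  then have "AE \<omega> in M. liminf (\<lambda>t. ennreal (X t \<omega>)) \<noteq> \<infinity>"
    by (intro nn_integral_PInf_AE) auto
  then show ?thesis
  proof (rule AE_mp, intro AE_I2 impI notI)
    fix \<omega> assume fin: "liminf (\<lambda>t. ennreal (X t \<omega>)) \<noteq> \<infinity>"
      and "filterlim (\<lambda>t. X t \<omega>) at_top sequentially"
    then have "(\<lambda>t. ennreal (X t \<omega>)) \<longlonglongrightarrow> \<infinity>"
      by (simp add: ennreal_tendsto_top_eq_at_top)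
    then have "liminf (\<lambda>t. ennreal (X t \<omega>)) = \<infinity>"
      by (intro lim_imp_Liminf) auto
    with fin show False by simp
  qed
qed

section \<open>The kernel of two-alternatives reinforcement\<close>

lemma finite_reinforce: "finite (set_pmf (reinforce T (n :: 'a::finite \<Rightarrow> nat)))"
  unfolding reinforce_def Let_def
  by (auto simp: set_bind_pmf intro!: finite_UN_I finite_subset[OF subset_UNIV finite_class.finite_UNIV])

text \<open>
  For all \<open>a\<close> and \<open>b\<close>, choosing the winner amounts to weighting \<open>a\<close> by \<open>(1 + payoff T a b) / 2\<close> and
  \<open>b\<close> by \<open>(1 + payoff T b a) / 2\<close>; the two halves contribute equally by symmetry.
\<close>
lemma expectation_reinforce:
  fixes f :: "('a::finite \<Rightarrow> nat) \<Rightarrow> real"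
  assumes T: "tournament T" and n: "urn n"
  shows "measure_pmf.expectation (reinforce T n) f = (\<Sum>x\<in>UNIV. pick_prob T n x * f (add_ball x n))"
proof -
  let ?m = "\<lambda>x. composition n $ x" and ?f = "\<lambda>x. f (add_ball x n)"
  have half: "f (n(tmax T a b := n (tmax T a b) + 1))
      = (1 + payoff T a b) / 2 * ?f a + (1 + payoff T b a) / 2 * ?f b" for a b
    using T by (simp add: tmax_def payoff_def tournament_def) (smt (verit))
  have "measure_pmf.expectation (reinforce T n) f
     = (\<Sum>a\<in>UNIV. ?m a * (\<Sum>b\<in>UNIV. ?m b * f (n(tmax T a b := n (tmax T a b) + 1))))"
    unfolding reinforce_def Let_def
    by (subst pmf_expectation_bind[of UNIV], simp, force, simp,
        subst pmf_expectation_bind[of UNIV]) (auto simp: pmf_draw[OF n])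
  also have "\<dots> = (\<Sum>a\<in>UNIV. \<Sum>b\<in>UNIV. ?m a * ?m b * ((1 + payoff T a b) / 2 * ?f a))
      + (\<Sum>a\<in>UNIV. \<Sum>b\<in>UNIV. ?m a * ?m b * ((1 + payoff T b a) / 2 * ?f b))"
    unfolding half sum.distrib[symmetric] sum_distrib_left
    by (intro sum.cong refl) (simp add: algebra_simps)
  also have "(\<Sum>a\<in>UNIV. \<Sum>b\<in>UNIV. ?m a * ?m b * ((1 + payoff T b a) / 2 * ?f b))
      = (\<Sum>a\<in>UNIV. \<Sum>b\<in>UNIV. ?m a * ?m b * ((1 + payoff T a b) / 2 * ?f a))"
    by (subst sum.swap) (simp add: mult_ac)
  also have "(\<Sum>a\<in>UNIV. \<Sum>b\<in>UNIV. ?m a * ?m b * ((1 + payoff T a b) / 2 * ?f a)) + \<dots>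
      = (\<Sum>a\<in>UNIV. ?m a * ((\<Sum>b\<in>UNIV. ?m b) + advantage T a (composition n)) * ?f a)"
    unfolding sum.distrib[symmetric] advantage_def sum_distrib_left sum_distrib_right
    by (intro sum.cong refl) (simp add: algebra_simps)
  finally show ?thesis by (simp add: sum_composition[OF n] pick_prob_def)
qed

lemma set_reinforce: "n' \<in> set_pmf (reinforce T n) \<Longrightarrow> \<exists>x. n' = add_ball x n"
  by (auto simp: reinforce_def Let_def)

section \<open>Sequences of real numbers\<close>

lemma summable_not_at_top:
  fixes f :: "nat \<Rightarrow> real"
  assumes pos: "\<And>n. 0 \<le> f n" and "\<not> filterlim (\<lambda>t. \<Sum>s<t. f s) at_top sequentially"
  shows "summable f"
proof -
  obtain Z where Z: "\<not> eventually (\<lambda>t. Z \<le> (\<Sum>s<t. f s)) sequentially"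
    using assms(2) by (auto simp: filterlim_at_top)
  have "(\<Sum>s<t. f s) \<le> Z" for t
  proof (rule ccontr)
    assume "\<not> (\<Sum>s<t. f s) \<le> Z"
    moreover have "(\<Sum>s<t. f s) \<le> (\<Sum>s<u. f s)" if "t \<le> u" for u
      using that pos by (intro sum_mono2) auto
    ultimately have "eventually (\<lambda>u. Z \<le> (\<Sum>s<u. f s)) sequentially"
      by (intro eventually_sequentiallyI[of t]) (meson dual_order.trans linear)
    with Z show False ..
  qed
  then have "(\<Sum>s\<le>t. f s) \<le> Z" for t unfolding lessThan_Suc_atMost[symmetric] by blast
  then show ?thesis using pos by (rule bounded_imp_summable[rotated])
qed

text \<open>
  A discrete form of Barbalat's lemma in logarithmic time. The increments of \<open>a^2\<close> are bounded by
  \<open>2 a(t) / (s + t) + 1 / (s + t)^2\<close>, which is summable, so \<open>a^2\<close> converges; a positive limit would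
  contradict the divergence of the harmonic series.
\<close>
lemma slowly_varying_summable_tendsto_0:
  fixes a :: "nat \<Rightarrow> real" and s :: nat
  assumes pos: "\<And>t. 0 \<le> a t" and s: "0 < s"
    and slow: "\<And>t. \<bar>a (Suc t) - a t\<bar> \<le> 1 / real (s + t)"
    and summ: "summable (\<lambda>t. a t / real (s + t))"
  shows "a \<longlonglongrightarrow> 0"
proof -
  have bd: "\<bar>(a (Suc t))\<^sup>2 - (a t)\<^sup>2\<bar> \<le> 2 * (a t / real (s + t)) + 1 / (real (s + t))\<^sup>2" for t
  proof -
    let ?h = "1 / real (s + t)"
    have h: "0 \<le> ?h" by simp
    have "\<bar>(a (Suc t))\<^sup>2 - (a t)\<^sup>2\<bar> = \<bar>a (Suc t) - a t\<bar> * (a (Suc t) + a t)"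
      using pos[of t] pos[of "Suc t"] by (simp add: square_diff_square_factored power2_eq_square abs_mult)
    also have "\<dots> \<le> ?h * (2 * a t + ?h)"
      using slow[of t] pos[of t] pos[of "Suc t"] by (intro mult_mono) auto
    finally show ?thesis by (simp add: power2_eq_square algebra_simps)
  qed
  have "summable (\<lambda>t. 2 * (a t / real (s + t)) + 1 / (real (s + t))\<^sup>2)"
  proof (intro summable_add summable_mult summ)
    have "summable (\<lambda>t. 1 / (real t)\<^sup>2)"
      using inverse_power_summable[of 2] by (simp add: inverse_eq_divide)
    then show "summable (\<lambda>t. 1 / (real (s + t))\<^sup>2)"
      by (subst (asm) summable_iff_shift[symmetric, of _ s]) (simp add: add.commute)
  qed
  then have "summable (\<lambda>t. (a (Suc t))\<^sup>2 - (a t)\<^sup>2)"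
    by (rule summable_comparison_test'[where N = 0]) (simp only: real_norm_def, rule bd)
  then obtain L where "(\<lambda>t. (a t)\<^sup>2 - (a 0)\<^sup>2) \<longlonglongrightarrow> L"
    by (auto simp: summable_iff_convergent sum_lessThan_telescope[of "\<lambda>t. (a t)\<^sup>2"] convergent_def)
  from tendsto_add[OF this tendsto_const[of "(a 0)\<^sup>2"]]
  have "(\<lambda>t. (a t)\<^sup>2) \<longlonglongrightarrow> L + (a 0)\<^sup>2" by simp
  then obtain c where c: "(\<lambda>t. (a t)\<^sup>2) \<longlonglongrightarrow> c" by blast
  have "0 \<le> c" by (rule LIMSEQ_le_const[OF c]) auto
  have "c = 0"
  proof (rule ccontr)
    assume "c \<noteq> 0"
    with \<open>0 \<le> c\<close> have "c / 2 < c" "0 < c" by auto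
    from order_tendstoD(1)[OF c this(1)]
    have ev: "eventually (\<lambda>t. sqrt (c / 2) \<le> a t) sequentially"
      by eventually_elim (use pos in \<open>simp add: real_le_lsqrt\<close>)
    have "summable (\<lambda>t. sqrt (c / 2) * (1 / real (s + t)))"
      by (rule summable_comparison_test_ev[OF _ summ])
        (use ev in eventually_elim, use \<open>0 < c\<close> in \<open>simp add: divide_right_mono\<close>)
    then have "summable (\<lambda>t. 1 / real (s + t))"
      using \<open>0 < c\<close> by (subst (asm) summable_cmult_iff) auto
    then have "summable (\<lambda>t. 1 / real t)"
      using summable_iff_shift[of "\<lambda>t. 1 / real t" s] by (simp add: add.commute)
    then show False using not_summable_harmonic[where 'a = real] by (simp add: inverse_eq_divide)
  qed
  with c have "(\<lambda>t. sqrt ((a t)\<^sup>2)) \<longlonglongrightarrow> sqrt 0" by (intro tendsto_real_sqrt) simp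
  then show ?thesis using pos by simp
qed

lemma cesaro_mean:
  fixes a :: "nat \<Rightarrow> real"
  assumes "a \<longlonglongrightarrow> L"
  shows "(\<lambda>t. (\<Sum>s<t. a s) / real t) \<longlonglongrightarrow> L"
proof (rule LIMSEQ_I)
  fix e :: real assume e: "0 < e"
  obtain T where T: "\<And>t. T \<le> t \<Longrightarrow> \<bar>a t - L\<bar> < e / 2"
    using LIMSEQ_D[OF assms, of "e / 2"] e by auto
  define C where "C = (\<Sum>s<T. \<bar>a s - L\<bar>)"
  have "(\<lambda>t. C / real t) \<longlonglongrightarrow> 0" by (rule lim_const_over_n)
  then obtain U where U: "\<And>t. U \<le> t \<Longrightarrow> C / real t < e / 2"
    using e order_tendstoD(2)[of "\<lambda>t. C / real t" 0 sequentially "e / 2"]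
    by (auto simp: eventually_sequentially)
  show "\<exists>U. \<forall>t\<ge>U. norm ((\<Sum>s<t. a s) / real t - L) < e"
  proof (intro exI allI impI)
    fix t assume t: "max (Suc T) U \<le> t"
    have "(\<Sum>s<t. a s) / real t - L = (\<Sum>s<t. a s - L) / real t"
      using t by (simp add: sum_subtractf field_simps)
    then have "norm ((\<Sum>s<t. a s) / real t - L) \<le> (\<Sum>s<t. \<bar>a s - L\<bar>) / real t"
      by (simp add: divide_right_mono)
    also have "(\<Sum>s<t. \<bar>a s - L\<bar>) = C + (\<Sum>s = T..<t. \<bar>a s - L\<bar>)"
      using t sum.atLeastLessThan_concat[of 0 T t "\<lambda>s. \<bar>a s - L\<bar>"] by (simp add: C_def lessThan_atLeast0)
    also have "\<dots> \<le> C + real (card {T..<t}) * (e / 2)"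
      by (intro add_left_mono sum_bounded_above) (use T in \<open>auto intro: less_imp_le\<close>)
    also have "\<dots> \<le> C + real t * (e / 2)" using e by simp
    finally have "norm ((\<Sum>s<t. a s) / real t - L) \<le> (C + real t * (e / 2)) / real t"
      by (simp add: divide_right_mono)
    also have "\<dots> = C / real t + e / 2" using t by (simp add: add_divide_distrib)
    also have "\<dots> < e"
    proof -
      have "U \<le> t" using t by simp
      from U[OF this] show ?thesis by linarith
    qed
    finally show "norm ((\<Sum>s<t. a s) / real t - L) < e" .
  qed
qed

section \<open>The urn process and the colours outside the support\<close>

locale urn_process = tournament_game T p
  for T :: "'a::finite \<Rightarrow> 'a \<Rightarrow> bool" and p :: "real ^ 'a" +
  fixes n0 :: "'a \<Rightarrow> nat" and M :: "'w measure" and N :: "nat \<Rightarrow> 'w \<Rightarrow> 'a \<Rightarrow> nat"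
  assumes n0: "urn n0" and chain: "markov_chain_from M (reinforce T) n0 N"
begin

sublocale markov_chain M "reinforce T" n0 N
  by unfold_locales (rule chain, rule finite_reinforce)

lemma path_urn:
  assumes "l \<in> set_pmf (path_pmf (reinforce T) n0 t)"
  shows "urn (hd l) \<and> total (hd l) = total n0 + t"
  using assms
proof (induction t arbitrary: l)
  case (Suc t)
  then obtain l' n where l: "l' \<in> set_pmf (path_pmf (reinforce T) n0 t)"
    "n \<in> set_pmf (reinforce T (hd l'))" "l = n # l'" by auto
  obtain x where x: "n = add_ball x (hd l')" using set_reinforce[OF l(2)] by blast
  show ?case
    using Suc.IH[OF l(1)] urn_add_ball[of "hd l'" x] total_add_ball[of "hd l'" x]
    unfolding l(3) list.sel x[symmetric] by simp
qed (simp add: n0)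

lemma AE_urn: "AE \<omega> in M. urn (N t \<omega>) \<and> total (N t \<omega>) = total n0 + t"
  using AE_hist[of t] by eventually_elim (use path_urn in fastforce)

lemma AE_path:
  "AE \<omega> in M. \<forall>t. urn (N t \<omega>) \<and> total (N t \<omega>) = total n0 + t \<and> (\<exists>x. N (Suc t) \<omega> = add_ball x (N t \<omega>))"
  unfolding AE_all_countable
proof
  fix t
  show "AE \<omega> in M. urn (N t \<omega>) \<and> total (N t \<omega>) = total n0 + t \<and> (\<exists>x. N (Suc t) \<omega> = add_ball x (N t \<omega>))"
    using AE_urn[of t] AE_hist[of "Suc t"]
  proof eventually_elim
    case (elim \<omega>)
    then have "N (Suc t) \<omega> \<in> set_pmf (reinforce T (N t \<omega>))" by auto
    with elim(1) set_reinforce show ?case by blast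
  qed
qed

lemma expectation_urn_step:
  fixes g :: "('a \<Rightarrow> nat) list \<Rightarrow> ('a \<Rightarrow> nat) \<Rightarrow> real"
  shows "expectation (\<lambda>\<omega>. g (history N t \<omega>) (N (Suc t) \<omega>))
    = expectation (\<lambda>\<omega>. \<Sum>x\<in>UNIV. pick_prob T (N t \<omega>) x * g (history N t \<omega>) (add_ball x (N t \<omega>)))"
  unfolding expectation_step
proof (rule integral_cong_AE)
  show "(\<lambda>\<omega>. measure_pmf.expectation (reinforce T (N t \<omega>)) (g (history N t \<omega>))) \<in> borel_measurable M"
    using borel_measurable_integrable[OF integrable_hist[of "\<lambda>l. measure_pmf.expectation (reinforce T (hd l)) (g l)" t]]
    by simp
  show "(\<lambda>\<omega>. \<Sum>x\<in>UNIV. pick_prob T (N t \<omega>) x * g (history N t \<omega>) (add_ball x (N t \<omega>))) \<in> borel_measurable M"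
    using borel_measurable_integrable[OF integrable_hist[of
          "\<lambda>l. \<Sum>x\<in>UNIV. pick_prob T (hd l) x * g l (add_ball x (hd l))" t]]
    by simp
  show "AE \<omega> in M. measure_pmf.expectation (reinforce T (N t \<omega>)) (g (history N t \<omega>))
     = (\<Sum>x\<in>UNIV. pick_prob T (N t \<omega>) x * g (history N t \<omega>) (add_ball x (N t \<omega>)))"
    using AE_urn[of t] by eventually_elim (simp add: expectation_reinforce[OF T])
qed

text \<open>
  The function may depend on the history up to time \<open>t\<close>: later it is a barrier whose scale is chosen
  at time \<open>t\<close>.
\<close>
lemma submartingale_expectation:
  fixes \<phi> :: "('a \<Rightarrow> nat) list \<Rightarrow> ('a \<Rightarrow> nat) \<Rightarrow> real"
  assumes sub: "\<And>l n. urn n \<Longrightarrow> \<phi> l n \<le> (\<Sum>x\<in>UNIV. pick_prob T n x * \<phi> l (add_ball x n))"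
  shows "expectation (\<lambda>\<omega>. \<phi> (history N t \<omega>) (N t \<omega>)) \<le> expectation (\<lambda>\<omega>. \<phi> (history N t \<omega>) (N (t + k) \<omega>))"
proof (induction k)
  case (Suc k)
  let ?u = "t + k"
  have "expectation (\<lambda>\<omega>. \<phi> (history N t \<omega>) (N ?u \<omega>))
     \<le> expectation (\<lambda>\<omega>. \<Sum>x\<in>UNIV. pick_prob T (N ?u \<omega>) x * \<phi> (history N t \<omega>) (add_ball x (N ?u \<omega>)))"
  proof (rule integral_mono_AE)
    show "integrable M (\<lambda>\<omega>. \<phi> (history N t \<omega>) (N ?u \<omega>))"
      using integrable_hist[of "\<lambda>l. \<phi> (drop k l) (hd l)" ?u] by (simp add: drop_hist)
    show "integrable M (\<lambda>\<omega>. \<Sum>x\<in>UNIV. pick_prob T (N ?u \<omega>) x * \<phi> (history N t \<omega>) (add_ball x (N ?u \<omega>)))"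
      using integrable_hist[of "\<lambda>l. \<Sum>x\<in>UNIV. pick_prob T (hd l) x * \<phi> (drop k l) (add_ball x (hd l))" ?u]
      by (simp add: drop_hist)
    show "AE \<omega> in M. \<phi> (history N t \<omega>) (N ?u \<omega>)
       \<le> (\<Sum>x\<in>UNIV. pick_prob T (N ?u \<omega>) x * \<phi> (history N t \<omega>) (add_ball x (N ?u \<omega>)))"
      using AE_urn[of ?u] by eventually_elim (simp add: sub)
  qed
  also have "\<dots> = expectation (\<lambda>\<omega>. \<phi> (history N t \<omega>) (N (Suc ?u) \<omega>))"
    using expectation_urn_step[of "\<lambda>l n. \<phi> (drop k l) n" ?u] by (simp add: drop_hist)
  finally show ?case using Suc by simp
qed simp

lemma expectation_N0: "expectation (\<lambda>\<omega>. f (N 0 \<omega>)) = (f n0 :: real)"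
  using expectation_hist[of "\<lambda>l. f (hd l)" 0] by simp

lemma expectation_potential:
  "expectation (\<lambda>\<omega>. potential (N t \<omega>)) + (\<Sum>s<t. expectation (\<lambda>\<omega>. dissipation (N s \<omega>))) = potential n0"
proof (induction t)
  case (Suc t)
  have "expectation (\<lambda>\<omega>. potential (N (Suc t) \<omega>))
     = expectation (\<lambda>\<omega>. \<Sum>x\<in>UNIV. pick_prob T (N t \<omega>) x * potential (add_ball x (N t \<omega>)))"
    by (rule expectation_urn_step[of "\<lambda>_. potential"])
  also have "\<dots> = expectation (\<lambda>\<omega>. potential (N t \<omega>) - dissipation (N t \<omega>))"
  proof (rule integral_cong_AE)
    show "(\<lambda>\<omega>. \<Sum>x\<in>UNIV. pick_prob T (N t \<omega>) x * potential (add_ball x (N t \<omega>))) \<in> borel_measurable M"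
      by (rule borel_measurable_integrable[OF integrable_state[of
            "\<lambda>n. \<Sum>x\<in>UNIV. pick_prob T n x * potential (add_ball x n)"]])
    show "(\<lambda>\<omega>. potential (N t \<omega>) - dissipation (N t \<omega>)) \<in> borel_measurable M"
      by (rule borel_measurable_integrable[OF integrable_state[of "\<lambda>n. potential n - dissipation n"]])
    show "AE \<omega> in M. (\<Sum>x\<in>UNIV. pick_prob T (N t \<omega>) x * potential (add_ball x (N t \<omega>)))
       = potential (N t \<omega>) - dissipation (N t \<omega>)"
      using AE_urn[of t] by eventually_elim (simp add: expected_potential)
  qed
  also have "\<dots> = expectation (\<lambda>\<omega>. potential (N t \<omega>)) - expectation (\<lambda>\<omega>. dissipation (N t \<omega>))"
    by (rule Bochner_Integration.integral_diff) (rule integrable_state)+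
  finally show ?case using Suc.IH by simp
qed (simp add: expectation_N0)

lemma AE_potential_nonneg: "AE \<omega> in M. 0 \<le> potential (N t \<omega>)"
  using AE_urn[of t] by eventually_elim (simp add: potential_nonneg)

lemma AE_potential_not_at_top: "AE \<omega> in M. \<not> filterlim (\<lambda>t. potential (N t \<omega>)) at_top sequentially"
proof (rule AE_not_at_top[of M "\<lambda>t \<omega>. potential (N t \<omega>)" "potential n0", OF integrable_state AE_potential_nonneg])
  fix t
  have "0 \<le> (\<Sum>s<t. expectation (\<lambda>\<omega>. dissipation (N s \<omega>)))"
    by (intro sum_nonneg integral_nonneg_AE) (simp add: dissipation_nonneg)
  with expectation_potential[of t] show "expectation (\<lambda>\<omega>. potential (N t \<omega>)) \<le> potential n0" by linarith
qed

lemma AE_summable_dissipation: "AE \<omega> in M. summable (\<lambda>t. dissipation (N t \<omega>))"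
proof -
  have "AE \<omega> in M. \<not> filterlim (\<lambda>t. \<Sum>s<t. dissipation (N s \<omega>)) at_top sequentially"
  proof (rule AE_not_at_top[of M "\<lambda>t \<omega>. \<Sum>s<t. dissipation (N s \<omega>)" "potential n0"])
    fix t
    show "integrable M (\<lambda>\<omega>. \<Sum>s<t. dissipation (N s \<omega>))"
      by (intro Bochner_Integration.integrable_sum integrable_state)
    show "AE \<omega> in M. 0 \<le> (\<Sum>s<t. dissipation (N s \<omega>))"
      by (simp add: sum_nonneg dissipation_nonneg)
    have "expectation (\<lambda>\<omega>. \<Sum>s<t. dissipation (N s \<omega>)) = (\<Sum>s<t. expectation (\<lambda>\<omega>. dissipation (N s \<omega>)))"
      by (intro Bochner_Integration.integral_sum integrable_state)
    moreover have "0 \<le> expectation (\<lambda>\<omega>. potential (N t \<omega>))"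
      by (intro integral_nonneg_AE AE_potential_nonneg)
    ultimately show "expectation (\<lambda>\<omega>. \<Sum>s<t. dissipation (N s \<omega>)) \<le> potential n0"
      using expectation_potential[of t] by linarith
  qed
  then show ?thesis
    by eventually_elim (rule summable_not_at_top, rule dissipation_nonneg)
qed

text \<open>
  The dissipation dominates \<open>gap * m(x) / S\<close> for every colour \<open>x\<close> outside the support, and it is
  almost surely summable.
\<close>
theorem AE_outside_vanishes:
  "AE \<omega> in M. \<forall>x. p $ x = 0 \<longrightarrow> (\<lambda>t. composition (N t \<omega>) $ x) \<longlonglongrightarrow> 0"
  using AE_path AE_summable_dissipation
proof eventually_elim
  case (elim \<omega>)
  show ?case
  proof (intro allI impI)
    fix y assume y: "p $ y = 0"
    have u: "urn (N t \<omega>)" and S: "total (N t \<omega>) = total n0 + t" for t using elim(1) by auto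
    have bound: "gap * (composition (N t \<omega>) $ y / real (total n0 + t)) \<le> dissipation (N t \<omega>)" for t
    proof -
      have "composition (N t \<omega>) $ y * gap \<le> composition (N t \<omega>) $ y * - advantage T y p"
        using advantage_le_gap[OF y] composition_pos[OF u, of t y] by (intro mult_left_mono) auto
      also have "\<dots> \<le> (\<Sum>x\<in>UNIV. composition (N t \<omega>) $ x * - advantage T x p)"
        using advantage_optimal_le composition_pos[OF u, of t]
        by (intro member_le_sum mult_nonneg_nonneg) (auto simp: less_imp_le)
      finally show ?thesis
        unfolding dissipation_def S by (simp add: divide_right_mono mult.commute)
    qed
    have "summable (\<lambda>t. gap * (composition (N t \<omega>) $ y / real (total n0 + t)))"
      by (rule summable_comparison_test'[OF elim(2), where N = 0])
        (use bound gap_pos composition_pos[OF u] in \<open>auto simp: less_imp_le\<close>)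
    then have "summable (\<lambda>t. composition (N t \<omega>) $ y / real (total n0 + t))"
      using gap_pos by (subst (asm) summable_cmult_iff) auto
    moreover have "\<bar>composition (N (Suc t) \<omega>) $ y - composition (N t \<omega>) $ y\<bar> \<le> 1 / real (total n0 + t)" for t
    proof -
      obtain x where x: "N (Suc t) \<omega> = add_ball x (N t \<omega>)" using elim(1) by blast
      have "\<bar>of_bool (x = y) - composition (N t \<omega>) $ y\<bar> \<le> 1"
        using composition_pos[OF u, of t y] composition_le_1[of "N t \<omega>" y] by (auto simp: abs_le_iff)
      then have "\<bar>of_bool (x = y) - composition (N t \<omega>) $ y\<bar> / (real (total n0 + t) + 1)
          \<le> 1 / real (total n0 + t)"
        using total_pos[OF n0] by (intro frac_le) auto
      then show ?thesis unfolding x composition_add_ball[OF u] S by simp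
    qed
    ultimately show "(\<lambda>t. composition (N t \<omega>) $ y) \<longlonglongrightarrow> 0"
      using total_pos[OF n0] composition_pos[OF u]
      by (intro slowly_varying_summable_tendsto_0[of _ "total n0"]) (auto simp: less_imp_le)
  qed
qed

section \<open>A law of large numbers for the draws\<close>

text \<open>
  The number of balls of colour \<open>x\<close> added so far, minus the sum of the conditional probabilities of
  adding one. The tail of the history drops the current state, from which no ball has been
  added yet.
\<close>
definition fluctuation :: "'a \<Rightarrow> ('a \<Rightarrow> nat) list \<Rightarrow> real" where
  "fluctuation x l = real (hd l x) - real (n0 x) - (\<Sum>n\<leftarrow>tl l. pick_prob T n x)"

lemma fluctuation_Cons:
  assumes "l \<noteq> []"
  shows "fluctuation x (n # l) = fluctuation x l + (real (n x) - real (hd l x) - pick_prob T (hd l) x)"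
  using assms by (cases l) (simp_all add: fluctuation_def)

text \<open>
  The fluctuation is a martingale whose increments have conditional variance at most \<open>1\<close>.
\<close>
lemma expectation_fluctuation_sq: "expectation (\<lambda>\<omega>. (fluctuation x (history N t \<omega>))\<^sup>2) \<le> real t"
proof (induction t)
  case 0
  have "expectation (\<lambda>\<omega>. (fluctuation x (history N 0 \<omega>))\<^sup>2) = 0"
    unfolding expectation_hist[of "\<lambda>l. (fluctuation x l)\<^sup>2"] by (simp add: fluctuation_def)
  then show ?case by simp
next
  case (Suc t)
  have ne: "history N t \<omega> \<noteq> []" for \<omega> by (cases t) auto
  have "expectation (\<lambda>\<omega>. (fluctuation x (history N (Suc t) \<omega>))\<^sup>2)
     = expectation (\<lambda>\<omega>. \<Sum>z\<in>UNIV. pick_prob T (N t \<omega>) z * (fluctuation x (add_ball z (N t \<omega>) # history N t \<omega>))\<^sup>2)"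
    using expectation_urn_step[of "\<lambda>l n. (fluctuation x (n # l))\<^sup>2" t] by simp
  also have "\<dots> \<le> expectation (\<lambda>\<omega>. (fluctuation x (history N t \<omega>))\<^sup>2 + 1)"
  proof (rule integral_mono_AE)
    show "integrable M (\<lambda>\<omega>. \<Sum>z\<in>UNIV. pick_prob T (N t \<omega>) z * (fluctuation x (add_ball z (N t \<omega>) # history N t \<omega>))\<^sup>2)"
      using integrable_hist[of "\<lambda>l. \<Sum>z\<in>UNIV. pick_prob T (hd l) z * (fluctuation x (add_ball z (hd l) # l))\<^sup>2" t]
      by simp
    show "integrable M (\<lambda>\<omega>. (fluctuation x (history N t \<omega>))\<^sup>2 + 1)"
      by (rule integrable_hist[of "\<lambda>l. (fluctuation x l)\<^sup>2 + 1"])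
    show "AE \<omega> in M. (\<Sum>z\<in>UNIV. pick_prob T (N t \<omega>) z * (fluctuation x (add_ball z (N t \<omega>) # history N t \<omega>))\<^sup>2)
       \<le> (fluctuation x (history N t \<omega>))\<^sup>2 + 1"
      using AE_urn[of t]
    proof eventually_elim
      case (elim \<omega>)
      define a where "a = fluctuation x (history N t \<omega>)"
      define q where "q = pick_prob T (N t \<omega>)"
      have q1: "(\<Sum>z\<in>UNIV. q z) = 1" unfolding q_def using sum_pick_prob[OF T] elim by blast
      have "(\<Sum>z\<in>UNIV. q z * (fluctuation x (add_ball z (N t \<omega>) # history N t \<omega>))\<^sup>2)
         = (\<Sum>z\<in>UNIV. q z * (a - q x)\<^sup>2 + (if z = x then q x * (1 + 2 * (a - q x)) else 0))"
        by (intro sum.cong refl)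
          (auto simp: fluctuation_Cons[OF ne] a_def[symmetric] q_def[symmetric] power2_eq_square algebra_simps)
      also have "\<dots> = (a - q x)\<^sup>2 + q x * (1 + 2 * (a - q x))"
        by (simp add: sum.distrib sum_distrib_right[symmetric] q1)
      also have "\<dots> \<le> a\<^sup>2 + 1"
        using zero_le_power2[of "q x - 1 / 2"] by (simp add: power2_eq_square algebra_simps)
      finally show ?case by (simp add: q_def a_def)
    qed
  qed
  also have "\<dots> = expectation (\<lambda>\<omega>. (fluctuation x (history N t \<omega>))\<^sup>2) + 1"
    using integrable_hist[of "\<lambda>l. (fluctuation x l)\<^sup>2"] by (simp add: prob_space)
  finally show ?case using Suc by simp
qed

lemma AE_fluctuation_not_at_top:
  "AE \<omega> in M. \<forall>x. \<not> filterlim (\<lambda>t. (fluctuation x (history N t \<omega>))\<^sup>2 / real t) at_top sequentially"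
proof (rule AE_finite_allI[OF finite_class.finite_UNIV, simplified])
  fix x
  show "AE \<omega> in M. \<not> filterlim (\<lambda>t. (fluctuation x (history N t \<omega>))\<^sup>2 / real t) at_top sequentially"
  proof (rule AE_not_at_top[of M "\<lambda>t \<omega>. (fluctuation x (history N t \<omega>))\<^sup>2 / real t" 1])
    fix t
    show "integrable M (\<lambda>\<omega>. (fluctuation x (history N t \<omega>))\<^sup>2 / real t)"
      by (rule integrable_hist[of "\<lambda>l. (fluctuation x l)\<^sup>2 / real t"])
    show "expectation (\<lambda>\<omega>. (fluctuation x (history N t \<omega>))\<^sup>2 / real t) \<le> 1"
      using expectation_fluctuation_sq[of x t] by (cases "t = 0") auto
  qed auto
qed

end

section \<open>Possible limits\<close>

context tournament_game
begin

lemma rel_entropy_self [simp]: "rel_entropy p p = 0"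
  by (simp add: rel_entropy_def)

lemma sum_limit_composition:
  assumes u: "\<And>t. urn (n t)" and lim: "(\<lambda>t. composition (n t)) \<longlonglongrightarrow> \<mu>"
  shows "(\<Sum>x\<in>UNIV. \<mu> $ x) = 1"
proof -
  have x: "(\<lambda>t. composition (n t) $ x) \<longlonglongrightarrow> \<mu> $ x" for x by (rule tendsto_vec_nth[OF lim])
  have "(\<lambda>t. \<Sum>x\<in>UNIV. composition (n t) $ x) \<longlonglongrightarrow> (\<Sum>x\<in>UNIV. \<mu> $ x)"
    by (intro tendsto_sum x)
  then show "(\<Sum>x\<in>UNIV. \<mu> $ x) = 1"
    by (simp add: sum_composition[OF u] LIMSEQ_const_iff)
qed

lemma potential_tendsto:
  assumes u: "\<And>t. urn (n t)" and tot: "filterlim (\<lambda>t. total (n t)) at_top sequentially"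
    and lim: "(\<lambda>t. composition (n t)) \<longlonglongrightarrow> \<mu>" and pos: "\<And>x. 0 < p $ x \<Longrightarrow> 0 < \<mu> $ x"
  shows "(\<lambda>t. potential (n t)) \<longlonglongrightarrow> rel_entropy p \<mu>"
proof -
  have x: "(\<lambda>t. composition (n t) $ x) \<longlonglongrightarrow> \<mu> $ x" for x by (rule tendsto_vec_nth[OF lim])
  have ent: "(\<lambda>t. p $ x * (ln (p $ x) - ln (composition (n t) $ x))) \<longlonglongrightarrow> p $ x * (ln (p $ x) - ln (\<mu> $ x))" for x
  proof (cases "p $ x = 0")
    case False
    then have "\<mu> $ x \<noteq> 0" using pos[of x] optimal_strategy_simplex(1)[of x] by simp
    then show ?thesis by (intro tendsto_intros x)
  qed simp
  have tot': "filterlim (\<lambda>t. real (total (n t))) at_top sequentially"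
    by (rule filterlim_compose[OF filterlim_real_sequentially tot])
  have "(\<lambda>t. p $ x * (harm_log_gap (total (n t)) - harm_log_gap (n t x))) \<longlonglongrightarrow> p $ x * (euler_mascheroni - euler_mascheroni)" for x
  proof (cases "p $ x = 0")
    case False
    then have "0 < \<mu> $ x" using pos[of x] optimal_strategy_simplex(1)[of x] by simp
    from filterlim_tendsto_pos_mult_at_top[OF x this tot']
    have "filterlim (\<lambda>t. real (n t x)) at_top sequentially"
      using total_pos[OF u] by (simp add: composition_nth)
    then have "filterlim (\<lambda>t. n t x) at_top sequentially"
      unfolding filterlim_at_top by (metis (mono_tags, lifting) eventually_mono of_nat_le_iff)
    then show ?thesis
      by (intro tendsto_intros filterlim_compose[OF harm_log_gap_tendsto] tot)
  qed simp
  then have "(\<lambda>t. rel_entropy p (composition (n t)) + (\<Sum>x\<in>UNIV. p $ x * (harm_log_gap (total (n t)) - harm_log_gap (n t x))))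
     \<longlonglongrightarrow> rel_entropy p \<mu> + (\<Sum>x\<in>UNIV. p $ x * (euler_mascheroni - euler_mascheroni))"
    unfolding rel_entropy_def by (intro tendsto_add tendsto_sum ent)
  then show ?thesis by (simp add: potential_eq_rel_entropy[OF u])
qed

text \<open>
  A colour of the support cannot become extinct while the potential stays bounded.
\<close>
lemma potential_at_top:
  assumes u: "\<And>t. urn (n t)" and x: "(\<lambda>t. composition (n t) $ x) \<longlonglongrightarrow> 0" and px: "0 < p $ x"
  shows "filterlim (\<lambda>t. potential (n t)) at_top sequentially"
proof -
  define c where "c = (\<Sum>y\<in>UNIV. p $ y * ln (p $ y))"
  have "filterlim (\<lambda>t. composition (n t) $ x) (at_right 0) sequentially"
    using x composition_pos[OF u] by (intro tendsto_imp_filterlim_at_right) auto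
  then have "filterlim (\<lambda>t. ln (composition (n t) $ x)) at_bot sequentially"
    by (rule filterlim_compose[OF ln_at_0])
  then have "filterlim (\<lambda>t. - ln (composition (n t) $ x)) at_top sequentially"
    by (simp add: filterlim_uminus_at_bot)
  then have "filterlim (\<lambda>t. c + p $ x * - ln (composition (n t) $ x)) at_top sequentially"
    by (intro filterlim_tendsto_add_at_top[OF tendsto_const]
        filterlim_tendsto_pos_mult_at_top[OF tendsto_const px])
  then show ?thesis
  proof (rule filterlim_at_top_mono, intro always_eventually allI)
    fix t
    have "ln (composition (n t) $ y) \<le> 0" for y
      using composition_pos[OF u, of t y] composition_le_1[of "n t" y] by simp
    then have "p $ x * - ln (composition (n t) $ x) \<le> (\<Sum>y\<in>UNIV. p $ y * - ln (composition (n t) $ y))"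
      by (intro member_le_sum mult_nonneg_nonneg) (auto simp: optimal_strategy_simplex)
    then have "c + p $ x * - ln (composition (n t) $ x) \<le> rel_entropy p (composition (n t))"
      by (simp add: c_def rel_entropy_def right_diff_distrib sum_subtractf sum_negf)
    also have "\<dots> \<le> potential (n t)" by (rule rel_entropy_le_potential[OF u])
    finally show "c + p $ x * - ln (composition (n t) $ x) \<le> potential (n t)" .
  qed
qed

end

lemma (in prob_space) expectation_of_bool:
  "expectation (\<lambda>\<omega>. of_bool (P \<omega>)) = prob {\<omega> \<in> space M. P \<omega>}"
proof -
  have "expectation (\<lambda>\<omega>. of_bool (P \<omega>) :: real) = expectation (indicator {\<omega> \<in> space M. P \<omega>})"
    by (intro Bochner_Integration.integral_cong) (auto simp: indicator_def)
  also have "\<dots> = prob ({\<omega> \<in> space M. P \<omega>} \<inter> space M)" by (rule Bochner_Integration.integral_indicator)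
  also have "{\<omega> \<in> space M. P \<omega>} \<inter> space M = {\<omega> \<in> space M. P \<omega>}" by auto
  finally show ?thesis .
qed

context urn_process
begin

lemma sum_list_tl_hist: "(\<Sum>n\<leftarrow>tl (history N t \<omega>). f n) = (\<Sum>s<t. f (N s \<omega>) :: real)"
proof (cases t)
  case (Suc u)
  have "(\<Sum>n\<leftarrow>history N u \<omega>. f n) = (\<Sum>s<Suc u. f (N s \<omega>))"
    by (induction u) simp_all
  then show ?thesis using Suc by simp
qed simp

text \<open>
  If the composition converges to \<open>\<mu>\<close>, then balls of colour \<open>x\<close> arrive at rate \<open>\<mu>(x)\<close>, whereas the
  conditional probabilities tend to \<open>\<mu>(x) (1 + g(x, \<mu>))\<close>.
\<close>
lemma fluctuation_limit:
  assumes tot: "\<And>t. total (N t \<omega>) = total n0 + t" and lim: "(\<lambda>t. composition (N t \<omega>)) \<longlonglongrightarrow> \<mu>"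
  shows "(\<lambda>t. fluctuation x (history N t \<omega>) / real t) \<longlonglongrightarrow> - (\<mu> $ x * advantage T x \<mu>)"
proof -
  have x: "(\<lambda>t. composition (N t \<omega>) $ x) \<longlonglongrightarrow> \<mu> $ x" for x by (rule tendsto_vec_nth[OF lim])
  have pick: "(\<lambda>t. pick_prob T (N t \<omega>) x) \<longlonglongrightarrow> \<mu> $ x * (1 + advantage T x \<mu>)"
    unfolding pick_prob_def advantage_def by (intro tendsto_intros x)
  have frac: "(\<lambda>t. real (total n0 + t) / real t) \<longlonglongrightarrow> 1"
  proof (rule Lim_transform_eventually)
    show "(\<lambda>t. real (total n0) / real t + 1) \<longlonglongrightarrow> 1"
      using tendsto_add[OF lim_const_over_n tendsto_const[of 1]] by simp
    show "eventually (\<lambda>t. real (total n0) / real t + 1 = real (total n0 + t) / real t) sequentially"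
      using eventually_gt_at_top[of 0] by eventually_elim (simp add: add_divide_distrib)
  qed
  have "(\<lambda>t. composition (N t \<omega>) $ x * (real (total n0 + t) / real t) - real (n0 x) / real t
       - (\<Sum>s<t. pick_prob T (N s \<omega>) x) / real t) \<longlonglongrightarrow> \<mu> $ x * 1 - 0 - \<mu> $ x * (1 + advantage T x \<mu>)"
    by (intro tendsto_diff tendsto_mult x frac lim_const_over_n cesaro_mean pick)
  moreover have "composition (N t \<omega>) $ x * (real (total n0 + t) / real t) - real (n0 x) / real t
       - (\<Sum>s<t. pick_prob T (N s \<omega>) x) / real t = fluctuation x (history N t \<omega>) / real t" for t
    using total_pos[OF n0]
    by (simp add: fluctuation_def sum_list_tl_hist composition_nth tot diff_divide_distrib)
  ultimately show ?thesis by (simp add: algebra_simps)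
qed

text \<open>
  A limit \<open>\<mu>\<close> must satisfy \<open>\<mu>(x) g(x, \<mu>) = 0\<close> for all \<open>x\<close>, since otherwise the squared fluctuation
  would grow quadratically in time. The same colours are present in \<open>\<mu>\<close> and in \<open>p\<close>, which leaves
  only \<open>\<mu> = p\<close>.
\<close>
lemma AE_limit:
  "AE \<omega> in M. \<forall>\<mu>. (\<lambda>t. composition (N t \<omega>)) \<longlonglongrightarrow> \<mu> \<longrightarrow> \<mu> = p"
  using AE_path AE_outside_vanishes AE_potential_not_at_top AE_fluctuation_not_at_top
proof eventually_elim
  case (elim \<omega>)
  have u: "urn (N t \<omega>)" and S: "total (N t \<omega>) = total n0 + t" for t using elim(1) by auto
  show ?case
  proof (intro allI impI)
    fix \<mu> assume lim: "(\<lambda>t. composition (N t \<omega>)) \<longlonglongrightarrow> \<mu>"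
    have x: "(\<lambda>t. composition (N t \<omega>) $ x) \<longlonglongrightarrow> \<mu> $ x" for x by (rule tendsto_vec_nth[OF lim])
    have rest: "\<mu> $ x * advantage T x \<mu> = 0" for x
    proof (rule ccontr)
      assume ne: "\<mu> $ x * advantage T x \<mu> \<noteq> 0"
      let ?r = "- (\<mu> $ x * advantage T x \<mu>)"
      have "(\<lambda>t. (fluctuation x (history N t \<omega>) / real t)\<^sup>2) \<longlonglongrightarrow> ?r\<^sup>2"
        by (intro tendsto_power fluctuation_limit S lim)
      moreover have "0 < ?r\<^sup>2" using ne by (simp add: zero_less_power2)
      ultimately have "filterlim (\<lambda>t. (fluctuation x (history N t \<omega>) / real t)\<^sup>2 * real t) at_top sequentially"
        by (rule filterlim_tendsto_pos_mult_at_top) (rule filterlim_real_sequentially)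
      also have "(\<lambda>t. (fluctuation x (history N t \<omega>) / real t)\<^sup>2 * real t)
          = (\<lambda>t. (fluctuation x (history N t \<omega>))\<^sup>2 / real t)"
        by (simp add: fun_eq_iff power_divide power2_eq_square)
      finally show False using elim(4) by blast
    qed
    show "\<mu> = p"
    proof (rule optimal_strategy_unique_rest)
      fix x assume "p $ x = 0"
      with elim(2) have "(\<lambda>t. composition (N t \<omega>) $ x) \<longlonglongrightarrow> 0" by blast
      with x show "\<mu> $ x = 0" by (rule LIMSEQ_unique)
    next
      show "(\<Sum>x\<in>UNIV. \<mu> $ x) = 1" by (rule sum_limit_composition[OF u lim])
    next
      fix x assume px: "0 < p $ x"
      have "\<mu> $ x \<noteq> 0"
      proof
        assume "\<mu> $ x = 0"
        with x[of x] have "filterlim (\<lambda>t. potential (N t \<omega>)) at_top sequentially"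
          by (intro potential_at_top[OF u _ px]) simp
        with elim(3) show False ..
      qed
      with rest[of x] show "advantage T x \<mu> = 0" by simp
    qed
  qed
qed

lemma AE_convergent_potential:
  "AE \<omega> in M. convergent (\<lambda>t. composition (N t \<omega>)) \<longrightarrow> (\<lambda>t. potential (N t \<omega>)) \<longlonglongrightarrow> 0"
  using AE_path AE_limit
proof eventually_elim
  case (elim \<omega>)
  have u: "urn (N t \<omega>)" and S: "total (N t \<omega>) = total n0 + t" for t using elim(1) by auto
  show ?case
  proof
    assume "convergent (\<lambda>t. composition (N t \<omega>))"
    then have "(\<lambda>t. composition (N t \<omega>)) \<longlonglongrightarrow> p" using elim(2) by (auto simp: convergent_def)
    moreover have "filterlim (\<lambda>t. total (N t \<omega>)) at_top sequentially"
      unfolding S by (rule filterlim_add_const_nat_at_top[of "total n0", unfolded add.commute[of _ "total n0"]])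
    ultimately have "(\<lambda>t. potential (N t \<omega>)) \<longlonglongrightarrow> rel_entropy p p"
      by (intro potential_tendsto u) auto
    then show "(\<lambda>t. potential (N t \<omega>)) \<longlonglongrightarrow> 0" by simp
  qed
qed

lemma measurable_composition [measurable]: "(\<lambda>\<omega>. composition (N t \<omega>)) \<in> borel_measurable M"
  by (rule measurable_compose[OF measurable_N]) simp

lemma sets_convergent [measurable]:
  "{\<omega> \<in> space M. convergent (\<lambda>t. composition (N t \<omega>))} \<in> sets M"
  unfolding Cauchy_convergent_iff[symmetric] by measurable

text \<open>
  Every colour can be added at any time, for instance by drawing it twice, so the order in which the
  missing balls are added is irrelevant.
\<close>
lemma reachable:
  assumes "\<And>x. n0 x \<le> n x" "total n = total n0 + k"
  shows "0 < prob {\<omega> \<in> space M. N k \<omega> = n}"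
  using assms
proof (induction k arbitrary: n)
  case 0
  have "n = n0"
  proof (rule ext, rule ccontr)
    fix x assume "n x \<noteq> n0 x"
    then have "total n0 < total n" unfolding total_def
      using 0(1) by (intro sum_strict_mono_ex1) (auto intro!: exI[of _ x] simp: less_le)
    then show False using 0 by simp
  qed
  have "AE \<omega> in M. N 0 \<omega> = n" unfolding \<open>n = n0\<close> using chain by (simp add: markov_chain_from_def)
  then have "prob {\<omega> \<in> space M. N 0 \<omega> = n} = 1" by (subst prob_Collect_eq_1) auto
  then show ?case by simp
next
  case (Suc k)
  obtain x where x: "n0 x < n x"
  proof (rule ccontr)
    assume "\<not> thesis"
    then have "n x \<le> n0 x" for x using that not_less by blast
    then have "total n \<le> total n0" unfolding total_def by (intro sum_mono)
    then show False using Suc by simp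
  qed
  define n' where "n' = n(x := n x - 1)"
  have n: "n = add_ball x n'" using x by (auto simp: n'_def)
  have le: "\<And>y. n0 y \<le> n' y" using Suc(2) x by (auto simp: n'_def)
  then have u: "urn n'" using n0 unfolding urn_def by (metis less_le_trans)
  have "total n' = total n0 + k" using Suc(3) unfolding n total_add_ball by simp
  with Suc.IH le have pos: "0 < prob {\<omega> \<in> space M. N k \<omega> = n'}" by blast
  have "0 < pick_prob T n' x"
  proof -
    have "advantage T x (composition n') > - 1"
    proof -
      have "composition n' $ x * 1 \<le> (\<Sum>y\<in>UNIV. composition n' $ y * (1 + payoff T x y))"
      proof -
        have "composition n' $ x * 1 = composition n' $ x * (1 + payoff T x x)"
          using T by (auto simp: payoff_def tournament_def)
        also have "\<dots> \<le> (\<Sum>y\<in>UNIV. composition n' $ y * (1 + payoff T x y))"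
          using composition_pos[OF u] abs_payoff_le[of T x]
          by (intro member_le_sum mult_nonneg_nonneg) (auto simp: less_imp_le abs_le_iff payoff_def)
        finally show ?thesis .
      qed
      also have "\<dots> = 1 + advantage T x (composition n')"
        by (simp add: advantage_def distrib_left sum.distrib sum_composition[OF u] mult.commute)
      finally show ?thesis using composition_pos[OF u, of x] by linarith
    qed
    then show ?thesis unfolding pick_prob_def using composition_pos[OF u, of x] by simp
  qed
  have "0 < prob {\<omega> \<in> space M. N k \<omega> = n'} * pick_prob T n' x" using pos \<open>0 < pick_prob T n' x\<close> by simp
  also have "\<dots> = expectation (\<lambda>\<omega>. of_bool (N k \<omega> = n') * pick_prob T n' x)"
    by (simp add: expectation_of_bool)
  also have "\<dots> \<le> expectation (\<lambda>\<omega>. \<Sum>z\<in>UNIV. pick_prob T (N k \<omega>) z * of_bool (add_ball z (N k \<omega>) = n))"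
  proof (rule integral_mono_AE)
    show "integrable M (\<lambda>\<omega>. of_bool (N k \<omega> = n') * pick_prob T n' x)"
      by (rule integrable_state[of "\<lambda>m. of_bool (m = n') * pick_prob T n' x"])
    show "integrable M (\<lambda>\<omega>. \<Sum>z\<in>UNIV. pick_prob T (N k \<omega>) z * of_bool (add_ball z (N k \<omega>) = n))"
      by (rule integrable_state[of "\<lambda>m. \<Sum>z\<in>UNIV. pick_prob T m z * of_bool (add_ball z m = n)"])
    show "AE \<omega> in M. of_bool (N k \<omega> = n') * pick_prob T n' x
        \<le> (\<Sum>z\<in>UNIV. pick_prob T (N k \<omega>) z * of_bool (add_ball z (N k \<omega>) = n))"
      using AE_urn[of k]
    proof eventually_elim
      case (elim \<omega>)
      have "pick_prob T (N k \<omega>) x * of_bool (add_ball x (N k \<omega>) = n)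
        \<le> (\<Sum>z\<in>UNIV. pick_prob T (N k \<omega>) z * of_bool (add_ball z (N k \<omega>) = n))"
        using elim pick_prob_bounds(1) by (intro member_le_sum mult_nonneg_nonneg) auto
      moreover have "of_bool (N k \<omega> = n') * pick_prob T n' x
          \<le> pick_prob T (N k \<omega>) x * of_bool (add_ball x (N k \<omega>) = n)"
        using elim pick_prob_bounds(1)[of "N k \<omega>" T x] by (cases "N k \<omega> = n'") (simp_all add: n)
      ultimately show ?case by linarith
    qed
  qed
  also have "\<dots> = expectation (\<lambda>\<omega>. of_bool (N (Suc k) \<omega> = n))"
    by (rule expectation_urn_step[of "\<lambda>_ m. of_bool (m = n)", symmetric])
  also have "\<dots> = prob {\<omega> \<in> space M. N (Suc k) \<omega> = n}"
    by (rule expectation_of_bool)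
  finally show ?case .
qed

end

section \<open>Escape from the optimal strategy\<close>

text \<open>
  A lower bound for the proportion of an event that lies outside \<open>A\<close> survives monotone limits. Used
  with \<open>A\<close> itself as a limit of such events, it shows that \<open>A\<close> is null.
\<close>
lemma (in prob_space) proportion_outside_monotone_limits:
  fixes c :: real
  assumes A: "A \<in> sets M" and B: "\<And>i :: nat. B i \<in> sets M" and le: "\<And>i. c * prob (B i) \<le> prob (B i - A)"
  shows "incseq B \<Longrightarrow> c * prob (\<Union>i. B i) \<le> prob ((\<Union>i. B i) - A)"
    and "decseq B \<Longrightarrow> c * prob (\<Inter>i. B i) \<le> prob ((\<Inter>i. B i) - A)"
proof -
  assume "incseq B"
  then have "(\<lambda>i. prob (B i)) \<longlonglongrightarrow> prob (\<Union>i. B i)"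
    using B by (intro finite_Lim_measure_incseq) auto
  moreover have "(\<lambda>i. prob (B i - A)) \<longlonglongrightarrow> prob (\<Union>i. B i - A)"
    using A B \<open>incseq B\<close> by (intro finite_Lim_measure_incseq) (auto simp: incseq_def)
  ultimately show "c * prob (\<Union>i. B i) \<le> prob ((\<Union>i. B i) - A)"
    unfolding UN_extend_simps by (intro LIMSEQ_le[OF tendsto_mult_left]) (auto simp: le)
next
  assume "decseq B"
  then have "(\<lambda>i. prob (B i)) \<longlonglongrightarrow> prob (\<Inter>i. B i)"
    using B by (intro finite_Lim_measure_decseq) auto
  moreover have "(\<lambda>i. prob (B i - A)) \<longlonglongrightarrow> prob (\<Inter>i. B i - A)"
    using A B \<open>decseq B\<close> by (intro finite_Lim_measure_decseq) (auto simp: decseq_def)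
  moreover have "(\<Inter>i. B i - A) = (\<Inter>i. B i) - A" by auto
  ultimately show "c * prob (\<Inter>i. B i) \<le> prob ((\<Inter>i. B i) - A)"
    by (auto intro!: LIMSEQ_le[OF tendsto_mult_left] simp: le)
qed

context tournament_game
begin

lemma exists_two_support:
  assumes "\<nexists>c. condorcet_winner T c"
  obtains a b where "a \<noteq> b" "0 < p $ a" "0 < p $ b"
proof -
  have "\<exists>x. 0 < p $ x \<and> x \<noteq> b" for b
  proof (rule ccontr)
    assume "\<nexists>x. 0 < p $ x \<and> x \<noteq> b"
    then have "p $ x = 0" if "x \<noteq> b" for x
      using that optimal_strategy_simplex(1)[of x] by (auto simp: less_le)
    then have "(\<Sum>x\<in>UNIV. p $ x) = (\<Sum>x\<in>UNIV. if x = b then p $ b else 0)"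
      by (intro sum.cong) auto
    with optimal_strategy_no_condorcet[OF assms, of b] optimal_strategy_simplex(2) show False by simp
  qed
  then show ?thesis using that by metis
qed

text \<open>
  The discreteness of the urn keeps the potential at least of order \<open>1 / S\<close>: at least two colours
  belong to the support, and one of them makes up at most half of the urn.
\<close>
lemma potential_ge_gap:
  assumes cw: "\<nexists>c. condorcet_winner T c" and n: "urn n"
  shows "gap / (2 * real (total n)) \<le> potential n"
proof -
  obtain a b where ab: "a \<noteq> b" "0 < p $ a" "0 < p $ b" by (rule exists_two_support[OF cw])
  have "n a + n b = (\<Sum>x\<in>{a, b}. n x)" using ab by simp
  also have "\<dots> \<le> total n" unfolding total_def by (intro sum_mono2) auto
  finally obtain x where x: "0 < p $ x" "2 * n x \<le> total n"
    using ab by (cases "n a \<le> n b") auto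
  have nx: "0 < n x" using n by (simp add: urn_def)
  have "1 / real (total n) \<le> 1 / real (n x) - 1 / real (total n)"
  proof -
    have "2 / real (total n) \<le> 2 / real (2 * n x)"
      using x nx by (intro divide_left_mono) auto
    then show ?thesis by simp
  qed
  also have "(1 / real (n x) - 1 / real (total n)) / 2 \<le> harm_log_gap (total n) - harm_log_gap (n x)"
    using nx by (intro harm_log_gap_increment le_total) auto
  finally have *: "1 / (2 * real (total n)) \<le> harm_log_gap (total n) - harm_log_gap (n x)" by simp
  have "gap / (2 * real (total n)) = gap * (1 / (2 * real (total n)))" by simp
  also have "\<dots> \<le> p $ x * (harm_log_gap (total n) - harm_log_gap (n x))"
    using * gap_le_support[OF x(1)] gap_pos by (intro mult_mono) auto
  also have "\<dots> \<le> (\<Sum>x\<in>UNIV. p $ x * (harm_log_gap (total n) - harm_log_gap (n x)))"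
    using n by (intro member_le_sum mult_nonneg_nonneg)
      (auto intro!: optimal_strategy_simplex harm_log_gap_mono le_total simp: urn_def Suc_le_eq)
  also have "\<dots> \<le> potential n"
  proof -
    have "0 \<le> rel_entropy p (composition n)"
      by (rule order_trans[OF sum_nonneg rel_entropy_ge_hellinger])
        (auto simp: optimal_strategy_simplex sum_composition n composition_pos less_imp_le)
    then show ?thesis unfolding potential_eq_rel_entropy[OF n] by simp
  qed
  finally show ?thesis .
qed

text \<open>
  The strategy \<open>q\<close> is obtained from \<open>p\<close> by moving a small mass to one colour \<open>b\<close> of the support; it
  differs from \<open>p\<close> because \<open>p\<close> is not concentrated on \<open>b\<close>.
\<close>
lemma exists_entropy_small:
  assumes cw: "\<nexists>c. condorcet_winner T c" and r: "0 < r"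
  obtains q where "\<And>x. 0 \<le> q $ x" "(\<Sum>x\<in>UNIV. q $ x) = 1" "\<And>x. 0 < p $ x \<Longrightarrow> 0 < q $ x"
    "\<And>x. p $ x = 0 \<Longrightarrow> q $ x = 0" "0 < rel_entropy p q" "rel_entropy p q \<le> r"
proof -
  obtain b where b: "0 < p $ b" by (rule exists_two_support[OF cw])
  have b1: "p $ b < 1" by (rule optimal_strategy_no_condorcet[OF cw])
  \<comment> \<open>Since \<open>q \<ge> e p\<close>, the relative entropy is at most \<open>- ln e = r\<close>.\<close>
  define e where "e = exp (- r)"
  have e: "0 < e" "e < 1" using r by (auto simp: e_def)
  define q where "q = (\<chi> x. e * p $ x + (if x = b then 1 - e else 0))"
  have q: "q $ x = e * p $ x + (if x = b then 1 - e else 0)" for x by (simp add: q_def)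
  have ge: "e * p $ x \<le> q $ x" for x using e by (simp add: q)
  have q0: "0 \<le> q $ x" for x using e optimal_strategy_simplex(1)[of x] by (simp add: q)
  have q1: "(\<Sum>x\<in>UNIV. q $ x) = 1"
    by (simp add: q sum.distrib sum_distrib_left[symmetric] optimal_strategy_simplex)
  have qpos: "0 < q $ x" if "0 < p $ x" for x
    using ge[of x] that e by (meson less_le_trans mult_pos_pos)
  have qz: "q $ x = 0" if "p $ x = 0" for x using that b by (auto simp: q)
  have "q $ b - p $ b = (1 - e) * (1 - p $ b)" by (simp add: q algebra_simps)
  moreover have "0 < (1 - e) * (1 - p $ b)" using e b1 by simp
  ultimately have "sqrt (p $ b) \<noteq> sqrt (q $ b)" by auto
  then have "0 < (sqrt (p $ b) - sqrt (q $ b))\<^sup>2" by simp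
  also have "\<dots> \<le> (\<Sum>x\<in>UNIV. (sqrt (p $ x) - sqrt (q $ x))\<^sup>2)" by (intro member_le_sum) auto
  also have "\<dots> \<le> rel_entropy p q"
    by (intro rel_entropy_ge_hellinger optimal_strategy_simplex q0 q1 qpos)
  finally have pos: "0 < rel_entropy p q" .
  have "p $ x * (ln (p $ x) - ln (q $ x)) \<le> p $ x * r" for x
  proof (cases "p $ x = 0")
    case False
    then have px: "0 < p $ x" using optimal_strategy_simplex(1)[of x] by simp
    have "ln (e * p $ x) \<le> ln (q $ x)" using ge[of x] px e qpos[OF px] by (subst ln_le_cancel_iff) auto
    then have "ln (p $ x) - ln (q $ x) \<le> r" using px e by (simp add: ln_mult e_def)
    then show ?thesis using px by simp
  qed simp
  then have "rel_entropy p q \<le> (\<Sum>x\<in>UNIV. p $ x * r)"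
    unfolding rel_entropy_def by (rule sum_mono)
  also have "\<dots> = r" by (simp add: sum_distrib_right[symmetric] optimal_strategy_simplex)
  finally show ?thesis using that q0 q1 qpos qz pos by blast
qed

lemma exists_urns_approximating:
  assumes q0: "\<And>x. 0 \<le> q $ x" and q1: "(\<Sum>x\<in>UNIV. q $ x) = 1" and n0: "urn n0"
  obtains n where "\<And>k x. n0 x \<le> n k x" "\<And>k. urn (n k)"
    "filterlim (\<lambda>k. total (n k)) at_top sequentially" "(\<lambda>k. composition (n k)) \<longlonglongrightarrow> q"
proof -
  define n where "n = (\<lambda>k x. n0 x + nat \<lfloor>real k * q $ x\<rfloor>)"
  have le: "n0 x \<le> n k x" for k x by (simp add: n_def)
  have u: "urn (n k)" for k using n0 le[of _ k] unfolding urn_def by (metis less_le_trans)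
  have lim: "(\<lambda>k. real (n k x) / real k) \<longlonglongrightarrow> q $ x" for x
  proof (rule tendsto_sandwich)
    show "(\<lambda>k. q $ x - 1 / real k) \<longlonglongrightarrow> q $ x"
      using tendsto_diff[OF tendsto_const lim_1_over_n] by simp
    show "(\<lambda>k. real (n0 x) / real k + q $ x) \<longlonglongrightarrow> q $ x"
      using tendsto_add[OF lim_const_over_n tendsto_const[of "q $ x"]] by simp
    have *: "real (n k x) = real (n0 x) + of_int \<lfloor>real k * q $ x\<rfloor>" for k
      using q0[of x] by (simp add: n_def)
    show "eventually (\<lambda>k. q $ x - 1 / real k \<le> real (n k x) / real k) sequentially"
      using eventually_gt_at_top[of 0]
    proof eventually_elim
      case (elim k)
      have "real k * q $ x - 1 \<le> real (n k x)" unfolding * by linarith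
      then have "(real k * q $ x - 1) / real k \<le> real (n k x) / real k" by (rule divide_right_mono) simp
      then show ?case using elim by (simp add: diff_divide_distrib)
    qed
    show "eventually (\<lambda>k. real (n k x) / real k \<le> real (n0 x) / real k + q $ x) sequentially"
      using eventually_gt_at_top[of 0]
    proof eventually_elim
      case (elim k)
      have "real (n k x) \<le> real (n0 x) + real k * q $ x" unfolding * by linarith
      then have "real (n k x) / real k \<le> (real (n0 x) + real k * q $ x) / real k"
        by (rule divide_right_mono) simp
      then show ?case using elim by (simp add: add_divide_distrib)
    qed
  qed
  have "(\<lambda>k. \<Sum>x\<in>UNIV. real (n k x) / real k) \<longlonglongrightarrow> (\<Sum>x\<in>UNIV. q $ x)"
    by (intro tendsto_sum lim)
  then have tot: "(\<lambda>k. real (total (n k)) / real k) \<longlonglongrightarrow> 1"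
    by (simp add: q1 total_def sum_divide_distrib)
  have comp: "(\<lambda>k. composition (n k)) \<longlonglongrightarrow> q"
  proof (rule vec_tendstoI)
    fix x
    have "(\<lambda>k. (real (n k x) / real k) / (real (total (n k)) / real k)) \<longlonglongrightarrow> q $ x / 1"
      by (intro tendsto_divide lim tot) simp
    moreover have "eventually (\<lambda>k. (real (n k x) / real k) / (real (total (n k)) / real k) = composition (n k) $ x) sequentially"
      using eventually_gt_at_top[of 0] by eventually_elim (simp add: composition_nth)
    ultimately show "(\<lambda>k. composition (n k) $ x) \<longlonglongrightarrow> q $ x"
      by (simp add: Lim_transform_eventually)
  qed
  have "filterlim (\<lambda>k. real (total (n k)) / real k * real k) at_top sequentially"
    by (rule filterlim_tendsto_pos_mult_at_top[OF tot _ filterlim_real_sequentially]) simp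
  then have "filterlim (\<lambda>k. real (total (n k))) at_top sequentially"
  proof (rule filterlim_at_top_mono, intro always_eventually allI)
    show "real (total (n k)) / real k * real k \<le> real (total (n k))" for k
      by (cases "k = 0") simp_all
  qed
  then have "filterlim (\<lambda>k. total (n k)) at_top sequentially"
    unfolding filterlim_at_top by (metis (mono_tags, lifting) eventually_mono of_nat_le_iff)
  with le u comp that show ?thesis by blast
qed

text \<open>
  In large urns with composition close to a fixed \<open>q\<close>, supported like \<open>p\<close> and at small positive
  entropy \<open>R\<close>, the terms for future noise and for the outside mass are negligible and the barrier is
  close to \<open>R (1 - near * R)\<close>.
\<close>
lemma exists_urn_barrier_pos:
  assumes cw: "\<nexists>c. condorcet_winner T c" and n0: "urn n0"
  obtains n where "\<And>x. n0 x \<le> n x" "0 < barrier near n"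
proof -
  have r: "0 < 1 / (2 * near)" using near_pos by simp
  obtain q where q: "\<And>x. 0 \<le> q $ x" "(\<Sum>x\<in>UNIV. q $ x) = 1" "\<And>x. 0 < p $ x \<Longrightarrow> 0 < q $ x"
    "\<And>x. p $ x = 0 \<Longrightarrow> q $ x = 0" "0 < rel_entropy p q" "rel_entropy p q \<le> 1 / (2 * near)"
    using exists_entropy_small[OF cw r] by blast
  obtain n where n: "\<And>k x. n0 x \<le> n k x" "\<And>k. urn (n k)"
    "filterlim (\<lambda>k. total (n k)) at_top sequentially" "(\<lambda>k. composition (n k)) \<longlonglongrightarrow> q"
    using exists_urns_approximating[OF q(1,2) n0] by blast
  let ?R = "rel_entropy p q"
  have D: "(\<lambda>k. potential (n k)) \<longlonglongrightarrow> ?R" by (rule potential_tendsto[OF n(2,3,4) q(3)])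
  have S: "(\<lambda>k. 1 / real (total (n k))) \<longlonglongrightarrow> 0"
    by (rule filterlim_compose[OF lim_1_over_n n(3)])
  have z: "(\<lambda>k. outside (n k)) \<longlonglongrightarrow> (\<Sum>y | p $ y = 0. q $ y)"
    unfolding outside_def by (intro tendsto_sum tendsto_vec_nth n(4))
  have "(\<lambda>k. potential (n k) - near * ((potential (n k))\<^sup>2 + 36 * potential (n k) * (1 / real (total (n k))))
     - 4 / gap * outside (n k)) \<longlonglongrightarrow> ?R - near * (?R\<^sup>2 + 36 * ?R * 0) - 4 / gap * (\<Sum>y | p $ y = 0. q $ y)"
    by (intro tendsto_intros D S z)
  then have "(\<lambda>k. barrier near (n k)) \<longlonglongrightarrow> ?R * (1 - near * ?R)"
    using q(4) by (simp add: barrier_def[abs_def] power2_eq_square algebra_simps)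
  moreover have "near * ?R \<le> 1 / 2" using q(6) near_pos by (simp add: field_simps)
  then have "0 < ?R * (1 - near * ?R)" using q(5) by simp
  ultimately have "eventually (\<lambda>k. 0 < barrier near (n k)) sequentially"
    by (rule order_tendstoD)
  then obtain k where "0 < barrier near (n k)" by (auto simp: eventually_sequentially)
  with n(1) that show ?thesis by blast
qed

end

context urn_process
begin

text \<open>
  If the composition converged almost surely, the positive part of the barrier, which is at most the
  potential, would tend to \<open>0\<close> boundedly. But its expectation is non-decreasing, and it is positive
  from the time when an urn with positive barrier can be reached.
\<close>
lemma prob_not_convergent_pos:
  assumes cw: "\<nexists>c. condorcet_winner T c"
  shows "0 < prob {\<omega> \<in> space M. \<not> convergent (\<lambda>t. composition (N t \<omega>))}"
proof (rule ccontr)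
  assume "\<not> 0 < prob {\<omega> \<in> space M. \<not> convergent (\<lambda>t. composition (N t \<omega>))}"
  then have 0: "prob {\<omega> \<in> space M. \<not> convergent (\<lambda>t. composition (N t \<omega>))} = 0"
    by (simp add: not_less measure_le_0_iff)
  have sets: "{\<omega> \<in> space M. \<not> convergent (\<lambda>t. composition (N t \<omega>))} \<in> sets M"
    using sets.compl_sets[OF sets_convergent] by (simp add: set_diff_eq cong: conj_cong)
  then have "AE \<omega> in M. convergent (\<lambda>t. composition (N t \<omega>))"
    using 0 by (subst AE_iff_measurable[OF sets refl]) (simp add: emeasure_eq_measure)
  then have lim: "AE \<omega> in M. (\<lambda>t. potential (N t \<omega>)) \<longlonglongrightarrow> 0"
    using AE_convergent_potential by eventually_elim simp
  define f where "f = (\<lambda>n. max 0 (barrier near n))"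
  have "(\<lambda>t. expectation (\<lambda>\<omega>. f (N t \<omega>))) \<longlonglongrightarrow> expectation (\<lambda>_. 0)"
  proof (rule integral_dominated_convergence)
    show "(\<lambda>\<omega>. f (N t \<omega>)) \<in> borel_measurable M" for t by (rule borel_measurable_integrable[OF integrable_state])
    show "integrable M (\<lambda>_. 1 / near)" by simp
    show "AE \<omega> in M. (\<lambda>t. f (N t \<omega>)) \<longlonglongrightarrow> 0"
      using lim AE_path
    proof eventually_elim
      case (elim \<omega>)
      have "f (N t \<omega>) \<le> potential (N t \<omega>)" for t
        using elim(2) barrier_le_potential[of "N t \<omega>" near] potential_nonneg[of "N t \<omega>"] near_pos
        by (simp add: f_def)
      then show ?case
        by (intro tendsto_sandwich[OF _ _ tendsto_const elim(1)]) (auto simp: f_def)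
    qed
    show "AE \<omega> in M. norm (f (N t \<omega>)) \<le> 1 / near" for t
      using AE_urn[of t] by eventually_elim (use barrier_le near_pos in \<open>simp add: f_def\<close>)
  qed simp
  then have lim0: "(\<lambda>t. expectation (\<lambda>\<omega>. f (N t \<omega>))) \<longlonglongrightarrow> 0" by simp
  obtain n where n: "\<And>x. n0 x \<le> n x" "0 < barrier near n"
    using exists_urn_barrier_pos[OF cw n0] by blast
  have "total n0 \<le> total n" unfolding total_def by (intro sum_mono n(1))
  then obtain k where k: "total n = total n0 + k" by (metis le_iff_add)
  define c where "c = prob {\<omega> \<in> space M. N k \<omega> = n} * f n"
  have "0 < c" using reachable[OF n(1) k] n(2) by (simp add: c_def f_def)
  have "c = expectation (\<lambda>\<omega>. of_bool (N k \<omega> = n) * f n)"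
    by (simp add: c_def expectation_of_bool)
  also have "\<dots> \<le> expectation (\<lambda>\<omega>. f (N k \<omega>))"
  proof (rule integral_mono)
    show "integrable M (\<lambda>\<omega>. of_bool (N k \<omega> = n) * f n)"
      by (rule integrable_state[of "\<lambda>m. of_bool (m = n) * f n"])
    show "of_bool (N k \<omega> = n) * f n \<le> f (N k \<omega>)" for \<omega>
      by (cases "N k \<omega> = n") (auto simp: f_def)
  qed (rule integrable_state)
  finally have "c \<le> expectation (\<lambda>\<omega>. f (N (k + i) \<omega>))" for i
    using submartingale_expectation[of "\<lambda>_. f" k i] barrier_submartingale[OF _ order_refl]
    by (force simp: f_def)
  then have "c \<le> 0"
    by (intro LIMSEQ_le_const[OF LIMSEQ_ignore_initial_segment[OF lim0, of k]]) (auto simp: add.commute)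
  with \<open>0 < c\<close> show False by simp
qed

text \<open>
  With \<open>l = escape_ratio / potential n\<close> and \<open>potential n \<ge> gap / (2 S)\<close>, the two terms that are subtracted
  from \<open>D\<close> in the barrier sum to at most \<open>D * escape_ratio * (1 + 72 / gap) = D / 2\<close>.
\<close>
definition escape_ratio :: real where
  "escape_ratio = gap / (2 * (gap + 72))"

lemma escape_ratio_pos: "0 < escape_ratio"
  using gap_pos by (simp add: escape_ratio_def)

lemma barrier_ge_half:
  assumes cw: "\<nexists>c. condorcet_winner T c" and full: "\<And>x. 0 < p $ x" and n: "urn n"
  shows "0 < potential n" "potential n / 2 \<le> barrier (escape_ratio / potential n) n"
proof -
  define D where "D = potential n"
  define S where "S = real (total n)"
  have S: "0 < S" using total_pos[OF n] by (simp add: S_def)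
  have DS: "gap / (2 * S) \<le> D" using potential_ge_gap[OF cw n] by (simp add: D_def S_def)
  moreover have "0 < gap / (2 * S)" using gap_pos S by simp
  ultimately have D: "0 < D" by linarith
  then show "0 < potential n" by (simp add: D_def)
  have "1 / S \<le> 2 * D / gap" using DS S gap_pos by (simp add: field_simps)
  then have "escape_ratio / D * (36 * D * (1 / S)) \<le> escape_ratio / D * (36 * D * (2 * D / gap))"
    using D escape_ratio_pos by (intro mult_left_mono) auto
  also have "\<dots> = D * (72 * escape_ratio / gap)" using D by simp
  finally have 1: "escape_ratio / D * (36 * D / S) \<le> D * (72 * escape_ratio / gap)" by simp
  have 2: "escape_ratio / D * D\<^sup>2 = D * escape_ratio" using D by (simp add: power2_eq_square)
  have "escape_ratio + 72 * escape_ratio / gap = 1 / 2"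
    using gap_pos by (simp add: escape_ratio_def divide_simps)
  then have 3: "D * escape_ratio + D * (72 * escape_ratio / gap) = D / 2"
    unfolding distrib_left[symmetric] by simp
  have "{y. p $ y = 0} = {}" using full by (metis (mono_tags, lifting) empty_Collect_eq less_irrefl)
  then have "outside n = 0" by (simp add: outside_def)
  then have "barrier (escape_ratio / D) n = D - (escape_ratio / D * D\<^sup>2 + escape_ratio / D * (36 * D / S))"
    by (simp add: barrier_def D_def S_def distrib_left)
  then show "potential n / 2 \<le> barrier (escape_ratio / potential n) n"
    using 1 2 3 unfolding D_def[symmetric] by linarith
qed

text \<open>
  Take the barrier at the scale given by the potential \<open>D\<close> at time \<open>t\<close>, divided by \<open>D\<close>.
  On \<open>E\<close> it starts at \<open>1 / 2\<close> or more, it never exceeds \<open>1 / escape_ratio\<close>, and it tends to \<open>0\<close> on \<open>A\<close>. As its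
  expectation does not decrease, \<open>E - A\<close> must carry the fraction \<open>escape_ratio / 2\<close> of the mass of \<open>E\<close>.
\<close>
lemma escape_probability:
  assumes cw: "\<nexists>c. condorcet_winner T c" and full: "\<And>x. 0 < p $ x"
    and A: "A \<in> sets M" "AE \<omega> in M. \<omega> \<in> A \<longrightarrow> (\<lambda>t. potential (N t \<omega>)) \<longlonglongrightarrow> 0"
    and E: "E = {\<omega> \<in> space M. R (history N t \<omega>)}" and R: "\<And>l. R l \<Longrightarrow> potential (hd l) \<le> escape_ratio / near"
  shows "escape_ratio / 2 * prob E \<le> prob (E - A)"
proof -
  define c where "c = (\<lambda>l. if R l \<and> 0 < potential (hd l) then 1 / potential (hd l) else 0)"
  define \<phi> where "\<phi> = (\<lambda>l n. c l * max 0 (barrier (escape_ratio / potential (hd l)) n))"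
  have c0: "0 \<le> c l" for l by (simp add: c_def)
  have E_sets: "E \<in> sets M" unfolding E by measurable
  have sub: "\<phi> l n \<le> (\<Sum>x\<in>UNIV. pick_prob T n x * \<phi> l (add_ball x n))" if "urn n" for l n
  proof (cases "R l \<and> 0 < potential (hd l)")
    case True
    then have "near \<le> escape_ratio / potential (hd l)"
      using R[of l] near_pos by (simp add: field_simps)
    then have "c l * max 0 (barrier (escape_ratio / potential (hd l)) n) \<le>
       c l * (\<Sum>x\<in>UNIV. pick_prob T n x * max 0 (barrier (escape_ratio / potential (hd l)) (add_ball x n)))"
      by (intro mult_left_mono barrier_submartingale that c0)
    then show ?thesis by (simp add: \<phi>_def sum_distrib_left mult_ac)
  qed (auto simp: \<phi>_def c_def)
  have int: "integrable M (\<lambda>\<omega>. \<phi> (history N t \<omega>) (N (t + k) \<omega>))" for k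
    using integrable_hist[of "\<lambda>l. \<phi> (drop k l) (hd l)" "t + k"] by (simp add: drop_hist)
  have bound: "AE \<omega> in M. \<phi> (history N t \<omega>) (N (t + k) \<omega>) \<le> 1 / escape_ratio * of_bool (R (history N t \<omega>))" for k
    using AE_urn[of "t + k"]
  proof eventually_elim
    case (elim \<omega>)
    show ?case
    proof (cases "R (history N t \<omega>) \<and> 0 < potential (N t \<omega>)")
      case True
      let ?D = "potential (N t \<omega>)"
      have "max 0 (barrier (escape_ratio / ?D) (N (t + k) \<omega>)) \<le> ?D / escape_ratio"
        using True escape_ratio_pos elim barrier_le[of "N (t + k) \<omega>" "escape_ratio / ?D"] by simp
      then have "1 / ?D * max 0 (barrier (escape_ratio / ?D) (N (t + k) \<omega>)) \<le> 1 / ?D * (?D / escape_ratio)"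
        using True by (intro mult_left_mono) auto
      then show ?thesis using True by (simp add: \<phi>_def c_def)
    qed (use escape_ratio_pos in \<open>auto simp: \<phi>_def c_def\<close>)
  qed
  have start: "prob E / 2 \<le> expectation (\<lambda>\<omega>. \<phi> (history N t \<omega>) (N t \<omega>))"
  proof -
    have "prob E / 2 = expectation (\<lambda>\<omega>. of_bool (R (history N t \<omega>)) / (2 :: real))"
      by (simp add: expectation_of_bool E)
    also have "\<dots> \<le> expectation (\<lambda>\<omega>. \<phi> (history N t \<omega>) (N t \<omega>))"
    proof (rule integral_mono_AE)
      show "integrable M (\<lambda>\<omega>. of_bool (R (history N t \<omega>)) / (2 :: real))"
        by (rule integrable_hist[of "\<lambda>l. of_bool (R l) / 2"])
      show "integrable M (\<lambda>\<omega>. \<phi> (history N t \<omega>) (N t \<omega>))" using int[of 0] by simp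
      show "AE \<omega> in M. of_bool (R (history N t \<omega>)) / 2 \<le> \<phi> (history N t \<omega>) (N t \<omega>)"
        using AE_urn[of t]
      proof eventually_elim
        case (elim \<omega>)
        let ?D = "potential (N t \<omega>)"
        have D: "0 < ?D" "?D / 2 \<le> barrier (escape_ratio / ?D) (N t \<omega>)"
          using barrier_ge_half[OF cw full] elim by blast+
        then have "1 / ?D * (?D / 2) \<le> 1 / ?D * max 0 (barrier (escape_ratio / ?D) (N t \<omega>))"
          by (intro mult_left_mono) auto
        then show ?case using D by (simp add: \<phi>_def c_def)
      qed
    qed
    finally show ?thesis .
  qed
  define r where "r = (\<lambda>k. expectation (\<lambda>\<omega>. indicator A \<omega> * \<phi> (history N t \<omega>) (N (t + k) \<omega>)))"
  have intA: "integrable M (\<lambda>\<omega>. indicator A \<omega> * \<phi> (history N t \<omega>) (N (t + k) \<omega>))" for k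
    using integrable_mult_indicator[OF A(1) int[of k]] by simp
  have le: "prob E / 2 \<le> 1 / escape_ratio * prob (E - A) + r k" for k
  proof -
    have "prob E / 2 \<le> expectation (\<lambda>\<omega>. \<phi> (history N t \<omega>) (N (t + k) \<omega>))"
      using start submartingale_expectation[of \<phi> t k, OF sub] by linarith
    also have "\<dots> \<le> expectation (\<lambda>\<omega>. 1 / escape_ratio * indicator (E - A) \<omega>
        + indicator A \<omega> * \<phi> (history N t \<omega>) (N (t + k) \<omega>))"
    proof (rule integral_mono_AE)
      show "integrable M (\<lambda>\<omega>. 1 / escape_ratio * indicator (E - A) \<omega>
          + indicator A \<omega> * \<phi> (history N t \<omega>) (N (t + k) \<omega>))"
        using A(1) E_sets
        by (intro Bochner_Integration.integrable_add integrable_mult_right integrable_real_indicator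
            intA) (auto simp: emeasure_eq_measure)
      show "AE \<omega> in M. \<phi> (history N t \<omega>) (N (t + k) \<omega>)
         \<le> 1 / escape_ratio * indicator (E - A) \<omega> + indicator A \<omega> * \<phi> (history N t \<omega>) (N (t + k) \<omega>)"
        using bound[of k] AE_space by eventually_elim (auto simp: E indicator_def)
    qed (rule int)
    also have "\<dots> = 1 / escape_ratio * prob (E - A) + r k"
      using A(1) E_sets intA[of k] unfolding r_def
      by (subst Bochner_Integration.integral_add) (auto simp: emeasure_eq_measure)
    finally show ?thesis .
  qed
  have "r \<longlonglongrightarrow> expectation (\<lambda>_. 0)"
    unfolding r_def
  proof (rule integral_dominated_convergence)
    show "(\<lambda>\<omega>. indicator A \<omega> * \<phi> (history N t \<omega>) (N (t + k) \<omega>)) \<in> borel_measurable M" for k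
      by (rule borel_measurable_integrable[OF intA])
    show "integrable M (\<lambda>_. 1 / escape_ratio)" by simp
    show "AE \<omega> in M. norm (indicator A \<omega> * \<phi> (history N t \<omega>) (N (t + k) \<omega>)) \<le> 1 / escape_ratio" for k
      using bound[of k]
    proof eventually_elim
      case (elim \<omega>)
      have "0 \<le> \<phi> (history N t \<omega>) (N (t + k) \<omega>)" using c0 by (simp add: \<phi>_def)
      moreover have "1 / escape_ratio * of_bool (R (history N t \<omega>)) \<le> 1 / escape_ratio" using escape_ratio_pos by simp
      ultimately show ?case using elim escape_ratio_pos by (auto simp: indicator_def)
    qed
    show "AE \<omega> in M. (\<lambda>k. indicator A \<omega> * \<phi> (history N t \<omega>) (N (t + k) \<omega>)) \<longlonglongrightarrow> 0"
      using A(2) AE_path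
    proof eventually_elim
      case (elim \<omega>)
      show ?case
      proof (cases "\<omega> \<in> A")
        case True
        have le: "\<phi> (history N t \<omega>) (N (t + k) \<omega>) \<le> c (history N t \<omega>) * potential (N (t + k) \<omega>)" for k
          unfolding \<phi>_def using elim(2) escape_ratio_pos c0[of "history N t \<omega>"] potential_nonneg
          by (intro mult_left_mono max.boundedI barrier_le_potential divide_nonneg_nonneg) (auto simp: less_imp_le)
        have "(\<lambda>k. potential (N (k + t) \<omega>)) \<longlonglongrightarrow> 0"
          using True elim(1) by (intro LIMSEQ_ignore_initial_segment) simp
        then have lim: "(\<lambda>k. c (history N t \<omega>) * potential (N (t + k) \<omega>)) \<longlonglongrightarrow> 0"
          using tendsto_mult_right_zero by (auto simp: add.commute)
        have "(\<lambda>k. \<phi> (history N t \<omega>) (N (t + k) \<omega>)) \<longlonglongrightarrow> 0"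
          by (rule tendsto_sandwich[OF _ _ tendsto_const lim])
            (use le c0 in \<open>auto simp: \<phi>_def\<close>)
        then show ?thesis using True by simp
      qed simp
    qed
  qed simp
  then have "(\<lambda>k. 1 / escape_ratio * prob (E - A) + r k) \<longlonglongrightarrow> 1 / escape_ratio * prob (E - A) + 0"
    by (intro tendsto_add tendsto_const) simp
  then have "prob E / 2 \<le> 1 / escape_ratio * prob (E - A) + 0"
    by (rule LIMSEQ_le_const) (use le in auto)
  then show ?thesis using escape_ratio_pos by (simp add: field_simps)
qed

text \<open>
  Let \<open>A\<close> be the event that the potential eventually stays below every positive level, hence almost
  surely tends to \<open>0\<close>. It is built by monotone limits from the events \<open>B j u k\<close>,
  which bound the potential during a finite time interval. These depend on a finite history that
  ends close to the optimal strategy, so a fixed fraction of each lies outside \<open>A\<close>. In the limit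
  a fixed fraction of \<open>A\<close> lies outside \<open>A\<close>.
\<close>
lemma AE_not_convergent:
  assumes cw: "\<nexists>c. condorcet_winner T c" and full: "\<And>x. 0 < p $ x"
  shows "AE \<omega> in M. \<not> convergent (\<lambda>t. composition (N t \<omega>))"
proof -
  define \<epsilon> where "\<epsilon> = (\<lambda>j. escape_ratio / near / real (Suc j))"
  have e0: "0 < \<epsilon> j" for j using escape_ratio_pos near_pos by (simp add: \<epsilon>_def)
  have e1: "\<epsilon> i \<le> \<epsilon> j" if "j \<le> i" for i j
    unfolding \<epsilon>_def using that escape_ratio_pos near_pos by (intro divide_left_mono) auto
  have e_lim: "\<epsilon> \<longlonglongrightarrow> 0"
    unfolding \<epsilon>_def by (rule LIMSEQ_Suc[OF lim_const_over_n])
  define B where "B = (\<lambda>j u k. {\<omega> \<in> space M. \<forall>s\<le>k. potential (N (u + s) \<omega>) \<le> \<epsilon> j})"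
  define A where "A = (\<Inter>j. \<Union>u. \<Inter>k. B j u k)"
  have B [measurable]: "B j u k \<in> sets M" for j u k unfolding B_def by measurable
  then have A_sets: "A \<in> sets M" unfolding A_def by measurable
  have A_iff: "\<omega> \<in> A \<longleftrightarrow> \<omega> \<in> space M \<and> (\<forall>j. \<exists>u. \<forall>s. potential (N (u + s) \<omega>) \<le> \<epsilon> j)" for \<omega>
  proof -
    have "(\<forall>k. \<forall>s\<le>k. P s) \<longleftrightarrow> (\<forall>s. P s)" for P :: "nat \<Rightarrow> bool" by blast
    then show ?thesis unfolding A_def B_def by auto
  qed
  have A_lim: "AE \<omega> in M. \<omega> \<in> A \<longrightarrow> (\<lambda>t. potential (N t \<omega>)) \<longlonglongrightarrow> 0"
    using AE_path
  proof (eventually_elim, intro impI LIMSEQ_I)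
    fix \<omega> and r :: real
    assume path: "\<forall>t. urn (N t \<omega>) \<and> total (N t \<omega>) = total n0 + t \<and> (\<exists>x. N (Suc t) \<omega> = add_ball x (N t \<omega>))"
      and "\<omega> \<in> A" and "0 < r"
    obtain j where j: "\<epsilon> j < r"
      using order_tendstoD(2)[OF e_lim \<open>0 < r\<close>] by (auto simp: eventually_sequentially)
    obtain u where u: "\<And>s. potential (N (u + s) \<omega>) \<le> \<epsilon> j" using \<open>\<omega> \<in> A\<close> A_iff by blast
    show "\<exists>u. \<forall>t\<ge>u. norm (potential (N t \<omega>) - 0) < r"
    proof (intro exI allI impI)
      fix t assume "u \<le> t"
      then show "norm (potential (N t \<omega>) - 0) < r"
        using u[of "t - u"] j path potential_nonneg[of "N t \<omega>"] by simp
    qed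
  qed
  have "escape_ratio / 2 * prob (B j u k) \<le> prob (B j u k - A)" for j u k
  proof (rule escape_probability[OF cw full A_sets A_lim])
    show "B j u k = {\<omega> \<in> space M. (\<lambda>l. l \<noteq> [] \<and> (\<forall>i\<le>k. potential (l ! i) \<le> \<epsilon> j)) (history N (u + k) \<omega>)}"
    proof -
      have "(\<forall>s\<le>k. potential (N (u + s) \<omega>) \<le> \<epsilon> j)
         \<longleftrightarrow> (\<forall>i\<le>k. potential (N (u + k - i) \<omega>) \<le> \<epsilon> j)" for \<omega>
      proof (intro iffI allI impI)
        fix i assume "\<forall>s\<le>k. potential (N (u + s) \<omega>) \<le> \<epsilon> j" "i \<le> k"
        then show "potential (N (u + k - i) \<omega>) \<le> \<epsilon> j"
          by (metis Nat.add_diff_assoc diff_le_self)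
      next
        fix s assume "\<forall>i\<le>k. potential (N (u + k - i) \<omega>) \<le> \<epsilon> j" "s \<le> k"
        then have "potential (N (u + k - (k - s)) \<omega>) \<le> \<epsilon> j" by (meson diff_le_self)
        then show "potential (N (u + s) \<omega>) \<le> \<epsilon> j" using \<open>s \<le> k\<close> by simp
      qed
      moreover have "history N (u + k) \<omega> \<noteq> []" for \<omega> using length_hist[of N "u + k" \<omega>] by fastforce
      ultimately show ?thesis by (auto simp: B_def hist_nth)
    qed
    fix l :: "('a \<Rightarrow> nat) list" assume "l \<noteq> [] \<and> (\<forall>i\<le>k. potential (l ! i) \<le> \<epsilon> j)"
    then have "potential (hd l) \<le> \<epsilon> j" by (simp add: hd_conv_nth)
    also have "\<epsilon> j \<le> \<epsilon> 0" by (rule e1) simp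
    finally show "potential (hd l) \<le> escape_ratio / near" by (simp add: \<epsilon>_def)
  qed
  then have "escape_ratio / 2 * prob (\<Inter>k. B j u k) \<le> prob ((\<Inter>k. B j u k) - A)" for j u
    by (intro proportion_outside_monotone_limits(2) A_sets B) (auto simp: B_def decseq_def)
  then have union: "escape_ratio / 2 * prob (\<Union>u. \<Inter>k. B j u k) \<le> prob ((\<Union>u. \<Inter>k. B j u k) - A)" for j
  proof (intro proportion_outside_monotone_limits(1) A_sets)
    show "incseq (\<lambda>u. \<Inter>k. B j u k)"
    proof (rule incseq_SucI, rule subsetI)
      fix u \<omega> assume "\<omega> \<in> (\<Inter>k. B j u k)"
      then have "\<omega> \<in> space M" "\<And>s. potential (N (u + s) \<omega>) \<le> \<epsilon> j" by (auto simp: B_def)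
      then show "\<omega> \<in> (\<Inter>k. B j (Suc u) k)" by (auto simp: B_def simp flip: add_Suc_right)
    qed
  qed measurable
  have "(\<Union>u. \<Inter>k. B j u k) \<in> sets M" for j by measurable
  then have "escape_ratio / 2 * prob (\<Inter>j. \<Union>u. \<Inter>k. B j u k) \<le> prob ((\<Inter>j. \<Union>u. \<Inter>k. B j u k) - A)"
  proof (rule proportion_outside_monotone_limits(2)[OF A_sets _ union])
    show "decseq (\<lambda>j. \<Union>u. \<Inter>k. B j u k)"
    proof (rule decseq_SucI)
      fix j
      have "B (Suc j) u k \<subseteq> B j u k" for u k
        using e1[of j "Suc j"] by (auto simp: B_def intro: order_trans)
      then show "(\<Union>u. \<Inter>k. B (Suc j) u k) \<subseteq> (\<Union>u. \<Inter>k. B j u k)" by blast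
    qed
  qed
  then have "escape_ratio / 2 * prob A \<le> 0" unfolding A_def[symmetric] by simp
  then have "prob A = 0"
    using escape_ratio_pos measure_nonneg[of M A] by (simp add: mult_le_0_iff)
  then have "AE \<omega> in M. \<omega> \<notin> A"
    using prob_eq_0[OF A_sets] by blast
  then show ?thesis
    using AE_convergent_potential AE_space
  proof eventually_elim
    case (elim \<omega>)
    show ?case
    proof
      assume "convergent (\<lambda>t. composition (N t \<omega>))"
      with elim(2) have lim: "(\<lambda>t. potential (N t \<omega>)) \<longlonglongrightarrow> 0" by blast
      have "\<exists>u. \<forall>s. potential (N (u + s) \<omega>) \<le> \<epsilon> j" for j
        using order_tendstoD(2)[OF lim e0[of j]]
        by (auto simp: eventually_sequentially intro: less_imp_le le_add1)
      with elim(1,3) show False by (simp add: A_iff)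
    qed
  qed
qed

end

theorem theorem7:
  fixes T :: "'a::finite \<Rightarrow> 'a \<Rightarrow> bool"
    and p :: "real ^ 'a"
    and n0 :: "'a \<Rightarrow> nat"
    and M :: "'w measure"
    and N :: "nat \<Rightarrow> 'w \<Rightarrow> 'a \<Rightarrow> nat"
  assumes "tournament T"
    and "optimal_strategy T p"
    and "urn n0"
    and "markov_chain_from M (reinforce T) n0 N"
  shows "(AE \<omega> in M. \<forall>x. p $ x = 0 \<longrightarrow> (\<lambda>t. composition (N t \<omega>) $ x) \<longlonglongrightarrow> 0)
       \<and> ((\<nexists>c. condorcet_winner T c) \<longrightarrow>
            0 < measure M {\<omega> \<in> space M. \<not> convergent (\<lambda>t. composition (N t \<omega>))})
       \<and> ((\<nexists>c. condorcet_winner T c) \<and> (\<forall>x. 0 < p $ x) \<longrightarrow>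
            (AE \<omega> in M. \<not> convergent (\<lambda>t. composition (N t \<omega>))))"
proof -
  interpret urn_process T p n0 M N
    by unfold_locales (fact assms)+
  show ?thesis
    using AE_outside_vanishes prob_not_convergent_pos AE_not_convergent by blast
qed

end
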